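(* Let $K\subset\mathbb{R}^3$ be a knot and $T_{K,\varepsilon}$ the boundary torus of its $\varepsilon$-tubular neighborhood, $\varepsilon>0$ small. Then $\mathcal L^\ast K$ and $\mathcal L^\ast_+T_{K,\varepsilon}$ are canonically Legendrian isotopic.
   Context: $\mathbb{R}^3$ carries the Euclidean metric. $S^\ast\mathbb{R}^3$ is the unit cotangent bundle with contact form $\lambda_1=p\,dq|_{S^\ast\mathbb{R}^3}$. For a submanifold $Q\subset\mathbb{R}^3$ the unit conormal bundle is $\mathcal L^\ast Q=\{(q,p)\in S^\ast\mathbb{R}^3:q\in Q,\ p|_{T_qQ}=0\}$, a Legendrian submanifold. For the torus $T_{K,\varepsilon}$, $\mathcal L^\ast T_{K,\varepsilon}$ has two connected components; $\mathcal L^\ast_+T_{K,\varepsilon}$ is the one determined by the co-orientation of $T_{K,\varepsilon}$ by normal vectors pointing into the tubular neighborhood of $K$. Two Legendrian submanifolds are Legendrian isotopic if there is a smooth ambient isotopy between them through Legendrian submanifolds. *)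

theory Defs
  imports "HOL-Analysis.Analysis"
begin

(* C_k and C_infinity are meant for open U only; smooth_on below handles arbitrary sets. *)

primrec C_k :: "nat \<Rightarrow> 'a::euclidean_space set \<Rightarrow> ('a \<Rightarrow> 'b::euclidean_space) \<Rightarrow> bool" where
  "C_k 0 U f \<longleftrightarrow> continuous_on U f"
| "C_k (Suc n) U f \<longleftrightarrow>
     (\<forall>x\<in>U. f differentiable (at x)) \<and>
     (\<forall>v. C_k n U (\<lambda>x. frechet_derivative f (at x) v))"

definition C_infinity :: "'a::euclidean_space set \<Rightarrow> ('a \<Rightarrow> 'b::euclidean_space) \<Rightarrow> bool" where
  "C_infinity U f \<longleftrightarrow> (\<forall>n. C_k n U f)"

(* A map on an arbitrary subset of a Euclidean space is smooth if it extends smoothly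
   to a neighbourhood of each point. *)
definition smooth_on :: "'a::euclidean_space set \<Rightarrow> ('a \<Rightarrow> 'b::euclidean_space) \<Rightarrow> bool" where
  "smooth_on S f \<longleftrightarrow>
     (\<forall>x\<in>S. \<exists>U g. open U \<and> x \<in> U \<and> C_infinity U g \<and> (\<forall>y\<in>U \<inter> S. g y = f y))"

definition diffeomorphism ::
    "'a::euclidean_space set \<Rightarrow> 'b::euclidean_space set \<Rightarrow> ('a \<Rightarrow> 'b) \<Rightarrow> bool" where
  "diffeomorphism S T f \<longleftrightarrow>
     bij_betw f S T \<and> smooth_on S f \<and> smooth_on T (inv_into S f)"

definition submanifold :: "nat \<Rightarrow> 'a::euclidean_space set \<Rightarrow> bool" where
  "submanifold k M \<longleftrightarrow>
     (\<forall>x\<in>M. \<exists>U V W \<phi>. open U \<and> x \<in> U \<and> open V \<and> subspace W \<and> dim W = k \<and>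
        diffeomorphism U V \<phi> \<and> \<phi> ` (U \<inter> M) = V \<inter> (W :: 'a set))"

(* Velocities of smooth curves in Q through q: the usual tangent space if Q is a submanifold. *)
definition tangent_space :: "'a::euclidean_space set \<Rightarrow> 'a \<Rightarrow> 'a set" where
  "tangent_space Q q =
     {v. \<exists>\<delta>>0. \<exists>c::real \<Rightarrow> 'a. smooth_on {-\<delta><..<\<delta>} c \<and> c ` {-\<delta><..<\<delta>} \<subseteq> Q \<and> c 0 = q \<and>
         (c has_vector_derivative v) (at 0)}"

type_synonym R3 = "real^3"

definition knot :: "R3 set \<Rightarrow> bool" where
  "knot K \<longleftrightarrow>
     (\<exists>\<gamma>::real \<Rightarrow> R3. smooth_on UNIV \<gamma> \<and> (\<forall>s. vector_derivative \<gamma> (at s) \<noteq> 0) \<and>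
        (\<forall>s. \<gamma> (s + 1) = \<gamma> s) \<and> inj_on \<gamma> {0..<1} \<and> K = range \<gamma>)"

(* A covector p at q is represented by a vector through the Euclidean metric, so that
   p applied to v is p \<bullet> v and the dual norm is the Euclidean one. *)
definition unit_cotangent :: "(R3 \<times> R3) set" where
  "unit_cotangent = {(q, p). norm p = 1}"

(* The form p dq at (q, p) on the tangent vector (v, w). *)
definition contact_form :: "R3 \<times> R3 \<Rightarrow> R3 \<times> R3 \<Rightarrow> real" where
  "contact_form z u = snd z \<bullet> fst u"

definition legendrian :: "(R3 \<times> R3) set \<Rightarrow> bool" where
  "legendrian \<Lambda> \<longleftrightarrow>
     \<Lambda> \<subseteq> unit_cotangent \<and> submanifold 2 \<Lambda> \<and>
     (\<forall>z\<in>\<Lambda>. \<forall>u\<in>tangent_space \<Lambda> z. contact_form z u = 0)"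

definition unit_conormal :: "R3 set \<Rightarrow> (R3 \<times> R3) set" where
  "unit_conormal Q =
     {(q, p). (q, p) \<in> unit_cotangent \<and> q \<in> Q \<and> (\<forall>v\<in>tangent_space Q q. p \<bullet> v = 0)}"

(* The image of the closed \<epsilon>-disc bundle in the normal bundle under (q, v) \<mapsto> q + v. *)
definition tubular_nbhd :: "R3 set \<Rightarrow> real \<Rightarrow> R3 set" where
  "tubular_nbhd K \<epsilon> =
     {q + v | q v. q \<in> K \<and> norm v \<le> \<epsilon> \<and> (\<forall>w\<in>tangent_space K q. v \<bullet> w = 0)}"

definition boundary_torus :: "R3 set \<Rightarrow> real \<Rightarrow> R3 set" where
  "boundary_torus K \<epsilon> = frontier (tubular_nbhd K \<epsilon>)"

(* The part of the unit conormal bundle of the torus consisting of the covectors dual to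
   normal vectors that point into the tubular neighbourhood. *)
definition inward_conormal :: "R3 set \<Rightarrow> real \<Rightarrow> (R3 \<times> R3) set" where
  "inward_conormal K \<epsilon> =
     {(q, p). (q, p) \<in> unit_conormal (boundary_torus K \<epsilon>) \<and>
        (\<exists>\<delta>>0. \<forall>t. 0 < t \<and> t < \<delta> \<longrightarrow> q + t *\<^sub>R p \<in> interior (tubular_nbhd K \<epsilon>))}"

definition legendrian_isotopy ::
    "(real \<Rightarrow> R3 \<times> R3 \<Rightarrow> R3 \<times> R3) \<Rightarrow> (R3 \<times> R3) set \<Rightarrow> (R3 \<times> R3) set \<Rightarrow> bool" where
  "legendrian_isotopy \<Phi> \<Lambda>\<^sub>0 \<Lambda>\<^sub>1 \<longleftrightarrow>
     smooth_on ({0..1} \<times> unit_cotangent) (\<lambda>(t, z). \<Phi> t z) \<and>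
     (\<forall>t\<in>{0..1}. diffeomorphism unit_cotangent unit_cotangent (\<Phi> t)) \<and>
     (\<forall>z\<in>unit_cotangent. \<Phi> 0 z = z) \<and>
     (\<forall>t\<in>{0..1}. legendrian (\<Phi> t ` \<Lambda>\<^sub>0)) \<and>
     \<Phi> 1 ` \<Lambda>\<^sub>0 = \<Lambda>\<^sub>1"

(* The cotangent lift of the isometry x \<mapsto> R x + b; since R is orthogonal, the inverse
   transpose of R acting on covectors is R itself. *)
definition isometry_lift :: "(R3 \<Rightarrow> R3) \<Rightarrow> R3 \<Rightarrow> R3 \<times> R3 \<Rightarrow> R3 \<times> R3" where
  "isometry_lift R b = (\<lambda>(q, p). (R q + b, R p))"

(* A choice of isotopy is canonical if it depends only on the subset K and on \<epsilon>,
   passes through the inward conormals of the tori of the intermediate radii (so that the path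
   of Legendrians is determined), and commutes with the isometries of the Euclidean space. *)
definition canonical_isotopies ::
    "(R3 set \<Rightarrow> real \<Rightarrow> real \<Rightarrow> R3 \<times> R3 \<Rightarrow> R3 \<times> R3) \<Rightarrow> bool" where
  "canonical_isotopies \<Phi> \<longleftrightarrow>
     (\<forall>K. knot K \<longrightarrow>
        (\<exists>\<epsilon>\<^sub>0>0. \<forall>\<epsilon>. 0 < \<epsilon> \<and> \<epsilon> < \<epsilon>\<^sub>0 \<longrightarrow>
           (\<forall>t. 0 < t \<and> t \<le> 1 \<longrightarrow>
              \<Phi> K \<epsilon> t ` unit_conormal K = inward_conormal K (t * \<epsilon>)))) \<and>
     (\<forall>K \<epsilon> R b. knot K \<and> \<epsilon> > 0 \<and> orthogonal_transformation R \<longrightarrow>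
        (\<forall>t\<in>{0..1}. \<forall>z\<in>unit_cotangent.
           \<Phi> ((\<lambda>x. R x + b) ` K) \<epsilon> t (isometry_lift R b z) =
           isometry_lift R b (\<Phi> K \<epsilon> t z)))"

end

theory Submission
  imports Defs
begin

text \<open>The isotopy is the geodesic flow of Euclidean space run backwards: at time \<open>t\<close> a
  covector \<open>(q, p)\<close> is moved to \<open>(q - t \<epsilon> p, p)\<close>. It starts at the identity, every stage is a
  linear automorphism of \<open>\<real>\<^sup>3 \<times> \<real>\<^sup>3\<close> preserving the unit covectors, and no choice enters, so
  it commutes with isometries. A covector conormal to \<open>K\<close> at \<open>q\<close> lands at distance
  \<open>t \<epsilon>\<close> from \<open>q\<close> and points back towards \<open>q\<close>. As long as \<open>t \<epsilon>\<close> is below the reach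
  of \<open>K\<close>, this is a point of the torus of radius \<open>t \<epsilon>\<close> with its inward conormal.

  Two facts carry the proof. The first is that a knot has positive reach in Federer's sense: the
  component of \<open>q' - q\<close> normal to \<open>K\<close> at \<open>q\<close> is bounded by a uniform multiple of
  \<open>\<bar>q' - q\<bar>\<^sup>2\<close> (\<open>reach_bound_exists\<close>). It follows that \<open>q + n\<close> has distance \<open>\<bar>n\<bar>\<close> from
  \<open>K\<close> for short normal vectors \<open>n\<close>, so the tubes and their boundaries are sublevel and level sets
  of the distance function. The conormals of a level set are found from its tangent vectors alone:
  the distance to the foot point \<open>q\<close> is minimal on the level set, which makes them orthogonal to
  \<open>n\<close>, and explicit curves along the meridian and the longitude show that there are no
  further constraints (\<open>conormal_of_distance_level\<close>, \<open>inward_conormal_eq\<close>).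

  The second is that the unit conormal bundle of \<open>K\<close> is a surface. Writing \<open>K\<close> locally as a
  graph over a line gives a straightening chart of \<open>\<real>\<^sup>3 \<times> \<real>\<^sup>3\<close> whose inverse is explicit
  (\<open>unit_conormal_chart\<close>), so that only the inverse function theorem in one variable is needed. The
  contact form vanishes on the moved surface because \<open>p \<bullet> dp = 0\<close> on unit covectors.\<close>

section \<open>Calculus of smooth maps\<close>

lemma C_k_cong:
  assumes "open U" "\<And>x. x \<in> U \<Longrightarrow> f x = g x" "C_k n U f"
  shows "C_k n U g"
  using assms
proof (induction n arbitrary: f g)
  case 0
  then show ?case by (metis C_k.simps(1) continuous_on_cong)
next
  case (Suc n)
  have d: "f differentiable (at x)" if "x \<in> U" for x
    using Suc.prems(3) that by simp
  have "g differentiable (at x)" if "x \<in> U" for x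
    using d[OF that] Suc.prems(1,2) that
    by (meson differentiable_def has_derivative_transform_within_open)
  moreover have "C_k n U (\<lambda>x. frechet_derivative g (at x) v)" for v
  proof (rule Suc.IH[OF Suc.prems(1)])
    show "frechet_derivative f (at x) v = frechet_derivative g (at x) v" if "x \<in> U" for x
      using frechet_derivative_transform_within_open[OF d[OF that] Suc.prems(1) that] Suc.prems(2)
      by metis
    show "C_k n U (\<lambda>x. frechet_derivative f (at x) v)"
      using Suc.prems(3) by simp
  qed
  ultimately show ?case by simp
qed

lemma C_k_SucI:
  assumes "open U" "\<And>x. x \<in> U \<Longrightarrow> (f has_derivative f' x) (at x)"
    and "\<And>v. C_k n U (\<lambda>x. f' x v)"
  shows "C_k (Suc n) U f"
proof -
  have "C_k n U (\<lambda>x. frechet_derivative f (at x) v)" for v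
    by (rule C_k_cong[OF assms(1) _ assms(3)[of v]]) (metis assms(2) frechet_derivative_at)
  then show ?thesis
    using assms(2) by (auto simp: differentiable_def)
qed

lemma C_k_Suc_imp: "C_k (Suc n) U f \<Longrightarrow> C_k n U f"
proof (induction n arbitrary: f)
  case 0
  then show ?case
    by (simp add: continuous_at_imp_continuous_on differentiable_imp_continuous_within)
next
  case (Suc n)
  then show ?case by (metis C_k.simps(2))
qed

lemma C_k_has_derivative:
  "C_k (Suc n) U f \<Longrightarrow> x \<in> U \<Longrightarrow> (f has_derivative frechet_derivative f (at x)) (at x)"
  by (simp flip: frechet_derivative_works)

lemma C_k_subset: "C_k n U f \<Longrightarrow> V \<subseteq> U \<Longrightarrow> C_k n V f"
  by (induction n arbitrary: f) (auto intro: continuous_on_subset)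

text \<open>Differentiability and derivatives are read off near each point, so local smoothness needs no
  gluing of the local pieces.\<close>

lemma C_k_local:
  assumes "\<And>x. x \<in> S \<Longrightarrow> \<exists>U. open U \<and> x \<in> U \<and> C_k n U f"
  shows "C_k n S f"
  using assms
proof (induction n arbitrary: f)
  case 0
  then show ?case
    by (metis C_k.simps(1) continuous_at_imp_continuous_on continuous_on_eq_continuous_at)
next
  case (Suc n)
  have "f differentiable (at x)" if "x \<in> S" for x
    using Suc.prems[OF that] by auto
  moreover have "C_k n S (\<lambda>x. frechet_derivative f (at x) v)" for v
    by (rule Suc.IH) (metis C_k.simps(2) Suc.prems)
  ultimately show ?case by simp
qed

lemma C_k_const: "C_k n U (\<lambda>x. c)"
  by (induction n arbitrary: c) auto

lemma C_k_bounded_linear: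
  assumes "open U" "bounded_linear f"
  shows "C_k n U f"
proof (cases n)
  case 0
  then show ?thesis using assms by (simp add: linear_continuous_on)
next
  case (Suc m)
  have "C_k (Suc m) U f"
    by (rule C_k_SucI[where f' = "\<lambda>x. f"])
      (use assms in \<open>auto intro: bounded_linear_imp_has_derivative C_k_const\<close>)
  then show ?thesis using Suc by simp
qed

lemma C_k_add:
  assumes "open U" "C_k n U f" "C_k n U g"
  shows "C_k n U (\<lambda>x. f x + g x)"
  using assms
proof (induction n arbitrary: f g)
  case 0
  then show ?case by (simp add: continuous_on_add)
next
  case (Suc n)
  show ?case
  proof (rule C_k_SucI[where f' = "\<lambda>x v. frechet_derivative f (at x) v + frechet_derivative g (at x) v"])
    show "((\<lambda>x. f x + g x) has_derivative
        (\<lambda>v. frechet_derivative f (at x) v + frechet_derivative g (at x) v)) (at x)" if "x \<in> U" for x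
      by (rule has_derivative_add[OF C_k_has_derivative[OF Suc.prems(2) that]
            C_k_has_derivative[OF Suc.prems(3) that]])
    show "C_k n U (\<lambda>x. frechet_derivative f (at x) v + frechet_derivative g (at x) v)" for v
      using Suc.prems by (intro Suc.IH) auto
  qed (rule assms(1))
qed

lemma C_k_sum:
  assumes "open U" "finite I" "\<And>i. i \<in> I \<Longrightarrow> C_k n U (f i)"
  shows "C_k n U (\<lambda>x. \<Sum>i\<in>I. f i x)"
  using assms(2,3) by (induction I) (simp_all add: C_k_const C_k_add[OF assms(1)])

lemma C_k_bilinear:
  assumes "bounded_bilinear h" "open U" "C_k n U f" "C_k n U g"
  shows "C_k n U (\<lambda>x. h (f x) (g x))"
  using assms(3,4)
proof (induction n arbitrary: f g)
  case 0
  then show ?case by (simp add: bounded_bilinear.continuous_on[OF assms(1)])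
next
  case (Suc n)
  show ?case
  proof (rule C_k_SucI[where f' = "\<lambda>x v. h (f x) (frechet_derivative g (at x) v)
                                  + h (frechet_derivative f (at x) v) (g x)"])
    show "((\<lambda>x. h (f x) (g x)) has_derivative
        (\<lambda>v. h (f x) (frechet_derivative g (at x) v) + h (frechet_derivative f (at x) v) (g x))) (at x)"
      if "x \<in> U" for x
      by (rule bounded_bilinear.FDERIV[OF assms(1) C_k_has_derivative[OF Suc.prems(1) that]
            C_k_has_derivative[OF Suc.prems(2) that]])
    show "C_k n U (\<lambda>x. h (f x) (frechet_derivative g (at x) v)
                    + h (frechet_derivative f (at x) v) (g x))" for v
      using Suc.prems C_k_Suc_imp[OF Suc.prems(1)] C_k_Suc_imp[OF Suc.prems(2)]
      by (intro C_k_add Suc.IH assms(2)) simp_all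
  qed (rule assms(2))
qed

text \<open>The chain rule turns a directional derivative of \<open>g \<circ> f\<close> into a combination of the partial
  derivatives of \<open>g\<close> along \<open>f\<close>, with coefficients that are derivatives of \<open>f\<close>; the
  induction on the order therefore has to run over all \<open>g\<close> at once.\<close>

lemma C_k_compose:
  assumes "open U" "open V" "f ` U \<subseteq> V" "C_k n U f" "C_k n V g"
  shows "C_k n U (\<lambda>x. g (f x))"
  using assms(4,5)
proof (induction n arbitrary: g)
  case 0
  then show ?case using assms(3) by (auto intro: continuous_on_compose2)
next
  case (Suc n)
  show ?case
  proof (rule C_k_SucI[where f' = "\<lambda>x v. \<Sum>b\<in>Basis. (frechet_derivative f (at x) v \<bullet> b) *\<^sub>R
            frechet_derivative g (at (f x)) b"])
    show "((\<lambda>x. g (f x)) has_derivative (\<lambda>v. \<Sum>b\<in>Basis. (frechet_derivative f (at x) v \<bullet> b) *\<^sub>R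
            frechet_derivative g (at (f x)) b)) (at x)" if "x \<in> U" for x
    proof -
      have f: "(f has_derivative frechet_derivative f (at x)) (at x)"
        using Suc.prems(1) that C_k_has_derivative by blast
      have g: "(g has_derivative frechet_derivative g (at (f x))) (at (f x))"
        using Suc.prems(2) that assms(3) C_k_has_derivative by blast
      have lin: "linear (frechet_derivative g (at (f x)))"
        using g has_derivative_linear by blast
      have "frechet_derivative g (at (f x)) (frechet_derivative f (at x) v) =
         (\<Sum>b\<in>Basis. (frechet_derivative f (at x) v \<bullet> b) *\<^sub>R frechet_derivative g (at (f x)) b)" for v
        by (subst euclidean_representation[symmetric, of "frechet_derivative f (at x) v"])
          (simp only: linear_sum[OF lin] linear_cmul[OF lin])
      then show ?thesis
        using has_derivative_compose[OF f g] by simp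
    qed
    show "C_k n U (\<lambda>x. \<Sum>b\<in>Basis. (frechet_derivative f (at x) v \<bullet> b) *\<^sub>R
            frechet_derivative g (at (f x)) b)" for v
    proof (intro C_k_sum C_k_bilinear[OF bounded_bilinear_scaleR] assms(1) finite_Basis)
      fix b :: 'b assume "b \<in> Basis"
      show "C_k n U (\<lambda>x. frechet_derivative f (at x) v \<bullet> b)"
        by (rule C_k_bilinear[OF bounded_bilinear_inner assms(1) _ C_k_const])
          (use Suc.prems(1) in simp)
      show "C_k n U (\<lambda>x. frechet_derivative g (at (f x)) b)"
        by (rule Suc.IH) (use Suc.prems C_k_Suc_imp in auto)
    qed
  qed (rule assms(1))
qed

lemma C_k_powr: "C_k n {0<..} (\<lambda>x::real. x powr a)"
proof (induction n arbitrary: a)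
  case 0
  then show ?case by (auto intro!: continuous_intros)
next
  case (Suc n)
  show ?case
  proof (rule C_k_SucI[where f' = "\<lambda>x v. v * (a * x powr (a - 1))"])
    show "((\<lambda>x. x powr a) has_derivative (\<lambda>v. v * (a * x powr (a - 1)))) (at x)" if "x \<in> {0<..}" for x
      using has_real_derivative_powr[of x a] that
      by (simp add: has_field_derivative_def mult_commute_abs)
    show "C_k n {0<..} (\<lambda>x::real. v * (a * x powr (a - 1)))" for v
      by (intro C_k_bilinear[OF bounded_bilinear_mult] C_k_const Suc) auto
  qed auto
qed

lemma C_infinity_cong:
  "open U \<Longrightarrow> (\<And>x. x \<in> U \<Longrightarrow> f x = g x) \<Longrightarrow> C_infinity U f \<Longrightarrow> C_infinity U g"
  unfolding C_infinity_def by (meson C_k_cong)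

lemma C_infinity_subset: "C_infinity U f \<Longrightarrow> V \<subseteq> U \<Longrightarrow> C_infinity V f"
  unfolding C_infinity_def by (meson C_k_subset)

lemma C_infinity_has_derivative:
  "C_infinity U f \<Longrightarrow> x \<in> U \<Longrightarrow> (f has_derivative frechet_derivative f (at x)) (at x)"
  unfolding C_infinity_def by (meson C_k_has_derivative)

lemma C_infinity_frechet_derivative:
  "C_infinity U f \<Longrightarrow> C_infinity U (\<lambda>x. frechet_derivative f (at x) v)"
  unfolding C_infinity_def by (metis C_k.simps(2))

lemma C_infinity_continuous_on: "C_infinity U f \<Longrightarrow> continuous_on U f"
  unfolding C_infinity_def by (metis C_k.simps(1))

lemma C_infinity_vector_derivative:
  fixes f :: "real \<Rightarrow> 'a::euclidean_space"
  assumes "open U" "C_infinity U f"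
  shows "C_infinity U (\<lambda>x. vector_derivative f (at x))"
proof (rule C_infinity_cong[OF assms(1) _ C_infinity_frechet_derivative[OF assms(2), of 1]])
  fix x assume "x \<in> U"
  then show "frechet_derivative f (at x) 1 = vector_derivative f (at x)"
    using C_infinity_has_derivative[OF assms(2)]
    by (metis differentiableI frechet_derivative_eq_vector_derivative scaleR_one)
qed

lemma C_infinity_has_vector_derivative:
  fixes f :: "real \<Rightarrow> 'a::euclidean_space"
  assumes "C_infinity U f" "x \<in> U"
  shows "(f has_vector_derivative vector_derivative f (at x)) (at x)"
  using C_infinity_has_derivative[OF assms] differentiableI vector_derivative_works by blast

lemma C_infinity_const [intro]: "C_infinity U (\<lambda>x. c)"
  unfolding C_infinity_def by (metis C_k_const)

lemma C_infinity_bounded_linear: "open U \<Longrightarrow> bounded_linear f \<Longrightarrow> C_infinity U f"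
  by (simp add: C_infinity_def C_k_bounded_linear)

lemma C_infinity_add:
  "open U \<Longrightarrow> C_infinity U f \<Longrightarrow> C_infinity U g \<Longrightarrow> C_infinity U (\<lambda>x. f x + g x)"
  by (simp add: C_infinity_def C_k_add)

lemma C_infinity_bilinear:
  "bounded_bilinear h \<Longrightarrow> open U \<Longrightarrow> C_infinity U f \<Longrightarrow> C_infinity U g \<Longrightarrow> C_infinity U (\<lambda>x. h (f x) (g x))"
  by (simp add: C_infinity_def C_k_bilinear)

lemma C_infinity_compose:
  "open U \<Longrightarrow> open V \<Longrightarrow> f ` U \<subseteq> V \<Longrightarrow> C_infinity U f \<Longrightarrow> C_infinity V g \<Longrightarrow> C_infinity U (\<lambda>x. g (f x))"
  unfolding C_infinity_def using C_k_compose[of U V f _ g] by simp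

lemma C_infinity_linear_compose:
  "bounded_linear l \<Longrightarrow> open U \<Longrightarrow> C_infinity U f \<Longrightarrow> C_infinity U (\<lambda>x. l (f x))"
  by (rule C_infinity_compose[where V = UNIV]) (auto intro: C_infinity_bounded_linear)

lemmas C_infinity_scaleR = C_infinity_bilinear[OF bounded_bilinear_scaleR]
lemmas C_infinity_mult = C_infinity_bilinear[OF bounded_bilinear_mult]
lemmas C_infinity_inner = C_infinity_bilinear[OF bounded_bilinear_inner]
lemmas C_infinity_fst = C_infinity_linear_compose[OF bounded_linear_fst]
lemmas C_infinity_snd = C_infinity_linear_compose[OF bounded_linear_snd]

lemma C_infinity_id: "open U \<Longrightarrow> C_infinity U (\<lambda>x. x)"
  by (rule C_infinity_bounded_linear) (auto simp: bounded_linear_ident)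

lemma C_infinity_diff:
  assumes "open U" "C_infinity U f" "C_infinity U g"
  shows "C_infinity U (\<lambda>x. f x - g x)"
  using C_infinity_add[OF assms(1,2) C_infinity_linear_compose[OF _ assms(1,3)], of uminus]
  by (simp add: bounded_linear_minus bounded_linear_ident)

lemma C_infinity_Pair:
  assumes "open U" "C_infinity U f" "C_infinity U g"
  shows "C_infinity U (\<lambda>x. (f x, g x))"
proof -
  have 1: "bounded_linear (\<lambda>a. (a, 0))" "bounded_linear (\<lambda>b. (0, b))"
    by (auto intro: bounded_linear_Pair bounded_linear_ident bounded_linear_zero)
  have "C_infinity U (\<lambda>x. (f x, 0) + (0, g x))"
    by (intro C_infinity_add assms(1) C_infinity_linear_compose[OF 1(1)]
        C_infinity_linear_compose[OF 1(2)] assms)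
  then show ?thesis by simp
qed

lemma C_infinity_powr:
  fixes f :: "'a::euclidean_space \<Rightarrow> real"
  assumes "open U" "C_infinity U f" "\<And>x. x \<in> U \<Longrightarrow> f x > 0"
  shows "C_infinity U (\<lambda>x. f x powr a)"
  by (rule C_infinity_compose[where V = "{0<..}"])
    (use assms in \<open>auto simp: C_infinity_def C_k_powr\<close>)

lemma C_infinity_inverse:
  fixes f :: "'a::euclidean_space \<Rightarrow> real"
  assumes "open U" "C_infinity U f" "\<And>x. x \<in> U \<Longrightarrow> f x > 0"
  shows "C_infinity U (\<lambda>x. inverse (f x))"
  by (rule C_infinity_cong[OF assms(1) _ C_infinity_powr[OF assms, of "-1"]])
    (use assms(3) in \<open>auto simp: powr_minus less_imp_le\<close>)

lemma C_infinity_norm: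
  assumes "open U" "C_infinity U f" "\<And>x. x \<in> U \<Longrightarrow> f x \<noteq> 0"
  shows "C_infinity U (\<lambda>x. norm (f x))"
proof (rule C_infinity_cong[OF assms(1)])
  show "C_infinity U (\<lambda>x. (f x \<bullet> f x) powr (1/2))"
    by (intro C_infinity_powr C_infinity_inner assms) (use assms(3) in auto)
qed (simp add: norm_eq_sqrt_inner powr_half_sqrt)

lemma smooth_on_open_iff:
  assumes "open S"
  shows "smooth_on S f \<longleftrightarrow> C_infinity S f"
proof
  assume L: "smooth_on S f"
  show "C_infinity S f"
    unfolding C_infinity_def
  proof
    fix n
    show "C_k n S f"
    proof (rule C_k_local)
      fix x assume "x \<in> S"
      then obtain U g where U: "open U" "x \<in> U" "C_infinity U g" "\<forall>y\<in>U \<inter> S. g y = f y"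
        using L unfolding smooth_on_def by blast
      have "C_infinity (U \<inter> S) g"
        using U(3) C_infinity_subset by blast
      then have "C_infinity (U \<inter> S) f"
        using U C_infinity_cong[of "U \<inter> S" g f] assms by auto
      then show "\<exists>U. open U \<and> x \<in> U \<and> C_k n U f"
        using U \<open>x \<in> S\<close> assms unfolding C_infinity_def by (metis IntI open_Int)
    qed
  qed
next
  assume "C_infinity S f"
  then show "smooth_on S f"
    unfolding smooth_on_def using assms by blast
qed

lemma smooth_on_if_C_infinity: "open U \<Longrightarrow> S \<subseteq> U \<Longrightarrow> C_infinity U f \<Longrightarrow> smooth_on S f"
  unfolding smooth_on_def by (metis subsetD)

lemma diffeomorphism_openI:
  assumes "open U" "open V" "C_infinity U f" "C_infinity V g"
    and "\<And>x. x \<in> U \<Longrightarrow> f x \<in> V \<and> g (f x) = x"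
    and "\<And>y. y \<in> V \<Longrightarrow> g y \<in> U \<and> f (g y) = y"
  shows "diffeomorphism U V f"
proof -
  have b: "bij_betw f U V"
    by (rule bij_betw_byWitness[where f' = g]) (use assms in auto)
  have "inv_into U f y = g y" if "y \<in> V" for y
    by (metis assms(6) b bij_betw_def inv_into_f_f that)
  then have "C_infinity V (inv_into U f)"
    using C_infinity_cong[OF assms(2) _ assms(4)] by metis
  then show ?thesis
    unfolding diffeomorphism_def smooth_on_open_iff[OF assms(1)] smooth_on_open_iff[OF assms(2)]
    using b assms(3) by blast
qed



lemma diffeomorphism_compose_open:
  assumes "diffeomorphism V W f" "open U" "open V" "open W"
    "C_infinity U l" "C_infinity V m"
    and "\<And>x. x \<in> U \<Longrightarrow> l x \<in> V \<and> m (l x) = x"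
    and "\<And>y. y \<in> V \<Longrightarrow> m y \<in> U \<and> l (m y) = y"
  shows "diffeomorphism U W (\<lambda>x. f (l x))"
proof (rule diffeomorphism_openI[where g = "\<lambda>y. m (inv_into V f y)"])
  have b: "bij_betw f V W" and s: "C_infinity V f" "C_infinity W (inv_into V f)"
    using assms(1,3,4) unfolding diffeomorphism_def by (auto simp: smooth_on_open_iff)
  have inv: "inv_into V f y \<in> V \<and> f (inv_into V f y) = y" if "y \<in> W" for y
    using b that by (metis bij_betw_def f_inv_into_f inv_into_into)
  have inv': "f x \<in> W \<and> inv_into V f (f x) = x" if "x \<in> V" for x
    using b that by (metis bij_betw_def image_eqI inv_into_f_f)
  show "C_infinity U (\<lambda>x. f (l x))" "C_infinity W (\<lambda>y. m (inv_into V f y))"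
    by (rule C_infinity_compose[where V = V]; use assms s inv in auto)+
  show "f (l x) \<in> W \<and> m (inv_into V f (f (l x))) = x" if "x \<in> U" for x
    using assms(7)[OF that] inv' by auto
  show "m (inv_into V f y) \<in> U \<and> f (l (m (inv_into V f y))) = y" if "y \<in> W" for y
    using assms(8) inv[OF that] by metis
qed (rule assms(2) assms(4))+

lemma submanifold_image:
  fixes m l :: "'a::euclidean_space \<Rightarrow> 'a"
  assumes "submanifold k M" "C_infinity UNIV m" "C_infinity UNIV l"
    and "\<And>x. l (m x) = x" "\<And>y. m (l y) = y"
  shows "submanifold k (m ` M)"
  unfolding submanifold_def
proof
  fix z assume "z \<in> m ` M"
  then obtain x where x: "x \<in> M" "z = m x" by blast
  obtain U V \<phi> and W :: "'a set" where c: "open U" "x \<in> U" "open V" "subspace W" "dim W = k"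
      "diffeomorphism U V \<phi>" "\<phi> ` (U \<inter> M) = V \<inter> W"
    using assms(1)[unfolded submanifold_def, rule_format, OF x(1)] by (elim exE conjE) (rule that)
  have U': "open (l -` U)"
    using C_infinity_continuous_on[OF assms(3)] c(1) by (simp add: open_vimage)
  have "diffeomorphism (l -` U) V (\<lambda>y. \<phi> (l y))"
    using assms(4,5) C_infinity_subset[OF assms(2), of U] C_infinity_subset[OF assms(3), of "l -` U"]
    by (intro diffeomorphism_compose_open[where m = m, OF c(6) U' c(1,3)]) simp_all
  moreover have "l ` (l -` U \<inter> m ` M) = U \<inter> M"
  proof
    show "U \<inter> M \<subseteq> l ` (l -` U \<inter> m ` M)"
      using assms(4) by (intro subsetI image_eqI[where x = "m _"]) auto
  qed (auto simp: assms(4))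
  then have "(\<lambda>y. \<phi> (l y)) ` (l -` U \<inter> m ` M) = \<phi> ` (U \<inter> M)"
    by (metis image_image)
  moreover have "z \<in> l -` U"
    using c(2) x(2) assms(4) by simp
  ultimately have "open (l -` U) \<and> z \<in> l -` U \<and> open V \<and> subspace W \<and> dim W = k \<and>
      diffeomorphism (l -` U) V (\<lambda>y. \<phi> (l y)) \<and> (\<lambda>y. \<phi> (l y)) ` (l -` U \<inter> m ` M) = V \<inter> W"
    using U' c(3-5,7) by (intro conjI) simp_all
  then show "\<exists>U V W \<phi>. open U \<and> z \<in> U \<and> open V \<and> subspace W \<and> dim W = k \<and>
      diffeomorphism U V \<phi> \<and> \<phi> ` (U \<inter> m ` M) = V \<inter> (W :: 'a set)"
    by (intro exI)
qed

text \<open>The derivative of the inverse \<open>g\<close> of \<open>h\<close> is \<open>1 / (h' \<circ> g)\<close>, so \<open>g\<close> gains one order of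
  differentiability over itself.\<close>

lemma C_infinity_inverse_function:
  fixes h g :: "real \<Rightarrow> real"
  assumes "open I" "open J" "C_infinity I h" "continuous_on J g"
    and "\<And>x. x \<in> I \<Longrightarrow> vector_derivative h (at x) > 0"
    and g: "\<And>y. y \<in> J \<Longrightarrow> g y \<in> I \<and> h (g y) = y"
  shows "C_infinity J g"
proof -
  define k where "k x = inverse (vector_derivative h (at x))" for x
  have k: "C_infinity I k"
    unfolding k_def by (intro C_infinity_inverse C_infinity_vector_derivative assms)
  have d: "(g has_derivative (\<lambda>v. v * k (g y))) (at y)" if "y \<in> J" for y
  proof -
    have "(h has_derivative (\<lambda>v. v *\<^sub>R vector_derivative h (at (g y)))) (at (g y))"
      using C_infinity_has_vector_derivative[OF assms(3)] g[OF that]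
      unfolding has_vector_derivative_def by blast
    then show ?thesis
    proof (rule has_derivative_inverse_basic[where T = J])
      show "isCont g y"
        using assms(2,4) that continuous_on_eq_continuous_at by blast
      have "vector_derivative h (at (g y)) > 0"
        using assms(5) g[OF that] by blast
      then show "(\<lambda>v. v * k (g y)) \<circ> (\<lambda>v. v *\<^sub>R vector_derivative h (at (g y))) = id"
        by (auto simp: k_def fun_eq_iff)
    qed (use assms that in \<open>auto intro: bounded_linear_intros\<close>)
  qed
  have "C_k n J g" for n
  proof (induction n)
    case 0
    then show ?case using assms(4) by simp
  next
    case (Suc n)
    show ?case
    proof (rule C_k_SucI[OF assms(2) d])
      show "C_k n J (\<lambda>y. v * k (g y))" for v
        by (intro C_k_bilinear[OF bounded_bilinear_mult] C_k_const assms(2)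
            C_k_compose[OF assms(2,1) _ Suc])
          (use g k in \<open>auto simp: C_infinity_def\<close>)
    qed
  qed
  then show ?thesis by (simp add: C_infinity_def)
qed

section \<open>Embedded curves as local graphs\<close>

text \<open>Parametrizing a curve by its coordinate \<open>x \<bullet> \<tau>\<close> along a fixed unit vector
  \<open>\<tau>\<close> makes the inverse of the parametrization a linear function, and gives
  \<open>\<bar>a - a'\<bar> \<le> dist (c a) (c a')\<close> for free. The set \<open>U\<close> cuts off the other strands of \<open>K\<close> with the same coordinates.\<close>

definition local_graph ::
    "'a::euclidean_space set \<Rightarrow> 'a \<Rightarrow> real set \<Rightarrow> (real \<Rightarrow> 'a) \<Rightarrow> 'a set \<Rightarrow> bool" where
  "local_graph K \<tau> J c U \<longleftrightarrow>
     norm \<tau> = 1 \<and> open J \<and> C_infinity J c \<and> (\<forall>a\<in>J. c a \<in> K \<and> c a \<bullet> \<tau> = a) \<and>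
     open U \<and> (\<forall>x\<in>U \<inter> K. x \<bullet> \<tau> \<in> J \<and> c (x \<bullet> \<tau>) = x)"

definition embedded_curve :: "'a::euclidean_space set \<Rightarrow> bool" where
  "embedded_curve K \<longleftrightarrow> (\<forall>q\<in>K. \<exists>\<tau> J c U. q \<in> U \<and> local_graph K \<tau> J c U)"

lemma periodic_int:
  fixes f :: "real \<Rightarrow> 'a"
  assumes "\<And>s. f (s + 1) = f s"
  shows "f (s + of_int n) = f s"
proof (induction n rule: int_induct[where k = 0])
  case base
  then show ?case by simp
next
  case (step1 i)
  then show ?case using assms[of "s + of_int i"] by (simp add: add.assoc)
next
  case (step2 i)
  then show ?case using assms[of "s + of_int (i - 1)"] by (simp add: add.assoc)
qed

lemma periodic_inj:
  fixes f :: "real \<Rightarrow> 'a"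
  assumes "\<And>s. f (s + 1) = f s" "inj_on f {0..<1}" "f s = f t" "0 \<le> t - s" "t - s < 1"
  shows "s = t"
proof -
  have *: "f (frac x) = f x" for x
    using periodic_int[of f x "- \<lfloor>x\<rfloor>"] assms(1) by (simp add: frac_def)
  have "frac s = frac t"
    by (rule inj_onD[OF assms(2)]) (use assms(3) in \<open>auto simp: * frac_ge_0 frac_lt_1\<close>)
  then obtain n :: int where n: "t - s = of_int n"
    by (metis frac_def add_diff_cancel_left' diff_add_cancel of_int_diff add_diff_eq)
  then have "n = 0"
    using assms(4,5) by simp
  with n show ?thesis by simp
qed

lemma knot_nonempty: "knot K \<Longrightarrow> K \<noteq> {}"
  unfolding knot_def by blast

lemma knot_compact:
  assumes "knot K"
  shows "compact K"
proof -
  obtain \<gamma> :: "real \<Rightarrow> R3" where \<gamma>: "smooth_on UNIV \<gamma>" "\<And>s. \<gamma> (s + 1) = \<gamma> s" "K = range \<gamma>"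
    using assms unfolding knot_def by blast
  have "\<gamma> s \<in> \<gamma> ` {0..1}" for s
    using periodic_int[of \<gamma> s "- \<lfloor>s\<rfloor>"] \<gamma>(2) frac_ge_0[of s] frac_lt_1[of s]
    by (intro image_eqI[of _ _ "frac s"]) (auto simp: frac_def)
  then have "K = \<gamma> ` {0..1}"
    using \<gamma>(3) by auto
  moreover have "continuous_on {0..1} \<gamma>"
    using \<gamma>(1) C_infinity_continuous_on continuous_on_subset
    by (metis open_UNIV smooth_on_open_iff subset_UNIV)
  ultimately show ?thesis
    using compact_continuous_image by blast
qed

text \<open>Near \<open>q = \<gamma> s\<^sub>0\<close> the coordinate along the tangent at \<open>q\<close> is strictly increasing in the
  parameter, so the knot can be reparametrized by it. Injectivity of \<open>\<gamma>\<close> on a period and compactness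
  keep the rest of the knot away from \<open>q\<close>.\<close>

lemma knot_embedded_curve:
  assumes "knot K"
  shows "embedded_curve K"
  unfolding embedded_curve_def
proof
  fix q assume "q \<in> K"
  obtain \<gamma> :: "real \<Rightarrow> R3" where \<gamma>: "C_infinity UNIV \<gamma>" "\<And>s. vector_derivative \<gamma> (at s) \<noteq> 0"
      "\<And>s. \<gamma> (s + 1) = \<gamma> s" "inj_on \<gamma> {0..<1}" "K = range \<gamma>"
    using assms unfolding knot_def smooth_on_open_iff[OF open_UNIV] by metis
  then obtain s0 where s0: "q = \<gamma> s0"
    using \<open>q \<in> K\<close> by blast
  define D where "D s = vector_derivative \<gamma> (at s)" for s
  define \<tau> where "\<tau> = D s0 /\<^sub>R norm (D s0)"
  define h where "h s = \<gamma> s \<bullet> \<tau>" for s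
  have contD: "continuous_on UNIV (\<lambda>s. D s \<bullet> \<tau>)"
    unfolding D_def
    by (intro continuous_intros C_infinity_continuous_on C_infinity_vector_derivative \<gamma>(1)) auto
  have d\<gamma>: "(\<gamma> has_vector_derivative D s) (at s)" for s
    unfolding D_def using C_infinity_has_vector_derivative[OF \<gamma>(1)] by simp
  have h: "C_infinity UNIV h"
    unfolding h_def by (intro C_infinity_inner C_infinity_const \<gamma>(1)) auto
  have dh: "(h has_real_derivative D s \<bullet> \<tau>) (at s)" for s
    using bounded_linear.has_vector_derivative[OF bounded_linear_inner_left d\<gamma>, of \<tau> s]
    unfolding h_def by (simp add: has_real_derivative_iff_has_vector_derivative)
  have "D s0 \<bullet> \<tau> > 0"
    using \<gamma>(2)[of s0] by (simp add: \<tau>_def D_def)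
  moreover have "open {s. D s \<bullet> \<tau> > 0}"
    using contD by (intro open_Collect_less) auto
  ultimately obtain e where e: "e > 0" "ball s0 e \<subseteq> {s. D s \<bullet> \<tau> > 0}"
    using openE by blast
  define \<delta> where "\<delta> = min e (1/2)"
  have \<delta>: "0 < \<delta>" "\<delta> \<le> 1/2"
    using e by (auto simp: \<delta>_def)
  define I where "I = {s0 - \<delta><..<s0 + \<delta>}"
  have pos: "D s \<bullet> \<tau> > 0" if "s \<in> I" for s
    using e that by (auto simp: I_def \<delta>_def dist_real_def subset_iff)
  have mono: "h s < h t" if "s \<in> I" "t \<in> I" "s < t" for s t
  proof (rule DERIV_pos_imp_increasing[OF that(3)])
    fix x assume "s \<le> x" "x \<le> t"
    then have "x \<in> I" using that by (simp add: I_def)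
    then show "\<exists>y. DERIV h x :> y \<and> 0 < y" using dh pos by blast
  qed
  have inj: "inj_on h I"
    by (rule inj_onI) (metis mono less_irrefl linorder_less_linear)
  have conth: "continuous_on I h"
    using C_infinity_continuous_on[OF h] continuous_on_subset by blast
  define J where "J = h ` I"
  obtain g where g: "homeomorphism I J h g"
    using inj injective_into_1d_eq_homeomorphism[OF conth] unfolding J_def I_def
    by (metis convex_real_interval(8) convex_imp_path_connected)
  have "open J"
    unfolding J_def using inj injective_eq_1d_open_map_UNIV[of I h] conth
    by (simp add: I_def is_interval_oo)
  have g': "g y \<in> I \<and> h (g y) = y" if "y \<in> J" for y
    using g that by (auto simp: homeomorphism_def)
  have "C_infinity J g"
  proof (rule C_infinity_inverse_function)
    show "C_infinity I h" using h C_infinity_subset by blast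
    show "vector_derivative h (at x) > 0" if "x \<in> I" for x
      using pos[OF that] dh[of x]
      by (metis has_real_derivative_iff_has_vector_derivative vector_derivative_at)
    show "continuous_on J g" using g by (simp add: homeomorphism_def)
  qed (use \<open>open J\<close> g' in \<open>auto simp: I_def\<close>)
  then have c: "C_infinity J (\<lambda>a. \<gamma> (g a))"
    by (rule C_infinity_compose[OF \<open>open J\<close> open_UNIV subset_UNIV _ \<gamma>(1)])
  define U where "U = - \<gamma> ` {s0 + \<delta>..s0 + 1 - \<delta>}"
  have "compact (\<gamma> ` {s0 + \<delta>..s0 + 1 - \<delta>})"
    using C_infinity_continuous_on[OF \<gamma>(1)] compact_continuous_image continuous_on_subset
    by (metis compact_Icc subset_UNIV)
  then have "open U"
    unfolding U_def by (simp add: compact_imp_closed open_Compl)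
  have "q \<in> U"
    using periodic_inj[of \<gamma> s0, OF \<gamma>(3,4)] s0 \<delta> by (force simp: U_def)
  have key: "x \<bullet> \<tau> \<in> J \<and> \<gamma> (g (x \<bullet> \<tau>)) = x" if x: "x \<in> U \<inter> K" for x
  proof -
    obtain s where s: "x = \<gamma> s" using x \<gamma>(5) by blast
    define t where "t = s0 + frac (s - s0)"
    have t: "x = \<gamma> t"
      using periodic_int[of \<gamma> s "- \<lfloor>s - s0\<rfloor>"] \<gamma>(3) s by (simp add: t_def frac_def)
    have t2: "s0 \<le> t" "t < s0 + 1"
      by (auto simp: t_def frac_lt_1)
    have t3: "t < s0 + \<delta> \<or> t > s0 + 1 - \<delta>"
      using x t t2 unfolding U_def by force
    obtain u where u: "u \<in> I" "x = \<gamma> u"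
    proof (cases "t < s0 + \<delta>")
      case True
      then show ?thesis using that[of t] t t2 \<delta> by (simp add: I_def)
    next
      case False
      then show ?thesis
        using that[of "t - 1"] t t2 t3 \<delta> \<gamma>(3)[of "t - 1"] by (simp add: I_def)
    qed
    have "x \<bullet> \<tau> = h u" using u by (simp add: h_def)
    moreover have "g (h u) = u" using g u(1) homeomorphism_apply1 by blast
    ultimately show ?thesis using u by (simp add: J_def)
  qed
  have "local_graph K \<tau> J (\<lambda>a. \<gamma> (g a)) U"
    unfolding local_graph_def
    using \<open>open J\<close> c g' \<open>open U\<close> key \<gamma>(5) \<gamma>(2)[of s0]
    by (auto simp: \<tau>_def D_def h_def)
  then show "\<exists>\<tau> J c U. q \<in> U \<and> local_graph K \<tau> J c U"
    using \<open>q \<in> U\<close> by blast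
qed

lemma graph_derivative_inner:
  assumes "local_graph K \<tau> J c U" "a \<in> J"
  shows "vector_derivative c (at a) \<bullet> \<tau> = 1"
proof -
  have "(c has_vector_derivative vector_derivative c (at a)) (at a)"
    using assms C_infinity_has_vector_derivative unfolding local_graph_def by blast
  then have "((\<lambda>x. c x \<bullet> \<tau>) has_vector_derivative vector_derivative c (at a) \<bullet> \<tau>) (at a)"
    by (rule bounded_linear.has_vector_derivative[OF bounded_linear_inner_left])
  then have "((\<lambda>x. x) has_vector_derivative vector_derivative c (at a) \<bullet> \<tau>) (at a)"
    by (rule has_vector_derivative_transform_within_open[where S = J])
      (use assms in \<open>auto simp: local_graph_def\<close>)
  then show ?thesis
    by (metis has_vector_derivative_id vector_derivative_at)
qed

text \<open>A curve in \<open>K\<close> is recovered from its coordinate along \<open>\<tau>\<close>, so its velocity is a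
  multiple of that of the graph.\<close>

lemma tangent_space_graph:
  assumes G: "local_graph K \<tau> J c U" and q: "q \<in> U \<inter> K"
  shows "tangent_space K q = range (\<lambda>k. k *\<^sub>R vector_derivative c (at (q \<bullet> \<tau>)))"
proof -
  have a: "q \<bullet> \<tau> \<in> J" "c (q \<bullet> \<tau>) = q"
    using assms unfolding local_graph_def by auto
  have dc: "(c has_vector_derivative vector_derivative c (at (q \<bullet> \<tau>))) (at (q \<bullet> \<tau>))"
    using G a C_infinity_has_vector_derivative unfolding local_graph_def by blast
  show ?thesis
  proof (intro equalityI subsetI)
    fix v assume "v \<in> tangent_space K q"
    then obtain \<delta> b where b: "\<delta> > 0" "smooth_on {-\<delta><..<\<delta>} b" "b ` {-\<delta><..<\<delta>} \<subseteq> K" "b 0 = q"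
        "(b has_vector_derivative v) (at 0)"
      unfolding tangent_space_def by blast
    have "isCont b 0"
      using b(5) has_vector_derivative_continuous by blast
    moreover have "open U" "b 0 \<in> U"
      using G q b(4) by (auto simp: local_graph_def)
    ultimately obtain S' where S': "open S'" "0 \<in> S'" "\<forall>s\<in>S'. b s \<in> U"
      by (metis continuous_at_open)
    define S where "S = S' \<inter> {-\<delta><..<\<delta>}"
    have S: "open S" "0 \<in> S" "\<And>s. s \<in> S \<Longrightarrow> c (b s \<bullet> \<tau>) = b s"
      using S' b(1,3) G by (auto simp: S_def local_graph_def image_subset_iff)
    have "((\<lambda>s. b s \<bullet> \<tau>) has_vector_derivative v \<bullet> \<tau>) (at 0)"
      using b(5) by (rule bounded_linear.has_vector_derivative[OF bounded_linear_inner_left])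
    then have "(c \<circ> (\<lambda>s. b s \<bullet> \<tau>) has_vector_derivative
        (v \<bullet> \<tau>) *\<^sub>R vector_derivative c (at (q \<bullet> \<tau>))) (at 0)"
      by (rule vector_diff_chain_at) (simp add: b(4) dc)
    then have "(b has_vector_derivative (v \<bullet> \<tau>) *\<^sub>R vector_derivative c (at (q \<bullet> \<tau>))) (at 0)"
      by (rule has_vector_derivative_transform_within_open[OF _ S(1,2)]) (simp add: S(3))
    with b(5) have "v = (v \<bullet> \<tau>) *\<^sub>R vector_derivative c (at (q \<bullet> \<tau>))"
      using vector_derivative_unique_at by blast
    then show "v \<in> range (\<lambda>k. k *\<^sub>R vector_derivative c (at (q \<bullet> \<tau>)))"
      by blast
  next
    fix v assume "v \<in> range (\<lambda>k. k *\<^sub>R vector_derivative c (at (q \<bullet> \<tau>)))"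
    then obtain k where k: "v = k *\<^sub>R vector_derivative c (at (q \<bullet> \<tau>))" by blast
    define l where "l s = q \<bullet> \<tau> + k * s" for s :: real
    have l: "C_infinity UNIV l"
      unfolding l_def by (intro C_infinity_add C_infinity_mult C_infinity_const C_infinity_id) auto
    have "open (l -` J)"
      using C_infinity_continuous_on[OF l] G by (simp add: open_vimage local_graph_def)
    then obtain \<delta> where \<delta>: "\<delta> > 0" "{-\<delta><..<\<delta>} \<subseteq> l -` J"
      using a(1) openE[of "l -` J" 0] by (auto simp: l_def ball_eq_greaterThanLessThan)
    have "C_infinity {-\<delta><..<\<delta>} (\<lambda>s. c (l s))"
      by (rule C_infinity_compose[where V = J])
        (use \<delta> G C_infinity_subset[OF l] in \<open>auto simp: local_graph_def\<close>)
    then have "smooth_on {-\<delta><..<\<delta>} (\<lambda>s. c (l s))"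
      by (simp add: smooth_on_open_iff)
    moreover have "(\<lambda>s. c (l s)) ` {-\<delta><..<\<delta>} \<subseteq> K"
      using \<delta>(2) G by (auto simp: local_graph_def)
    moreover have "(l has_vector_derivative k) (at 0)"
      unfolding l_def by (auto intro!: derivative_eq_intros simp flip: has_real_derivative_iff_has_vector_derivative)
    then have "(c \<circ> l has_vector_derivative v) (at 0)"
      unfolding k by (rule vector_diff_chain_at) (simp add: l_def dc)
    ultimately show "v \<in> tangent_space K q"
      unfolding tangent_space_def using \<delta>(1) a(2)
      by (auto simp: l_def comp_def intro!: exI[of _ \<delta>] exI[of _ "\<lambda>s. c (l s)"])
  qed
qed

corollary normal_graph_iff:
  assumes "local_graph K \<tau> J c U" "q \<in> U \<inter> K"
  shows "(\<forall>v\<in>tangent_space K q. p \<bullet> v = 0) \<longleftrightarrow> p \<bullet> vector_derivative c (at (q \<bullet> \<tau>)) = 0"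
  by (subst tangent_space_graph[OF assms]) (auto dest: spec[of _ 1])

section \<open>Positive reach and distance tubes\<close>

lemma has_vector_derivative_quotient:
  fixes f :: "real \<Rightarrow> 'a::euclidean_space"
  assumes "(f has_vector_derivative d) (at 0)"
  shows "((\<lambda>s. (f s - f 0) /\<^sub>R s) \<longlongrightarrow> d) (at 0)"
  unfolding tendsto_componentwise_iff[of "\<lambda>s. (f s - f 0) /\<^sub>R s"]
proof
  fix b :: 'a
  have "((\<lambda>s. f s \<bullet> b) has_real_derivative d \<bullet> b) (at 0)"
    using bounded_linear.has_vector_derivative[OF bounded_linear_inner_left assms]
    by (simp add: has_real_derivative_iff_has_vector_derivative)
  then show "((\<lambda>s. ((f s - f 0) /\<^sub>R s) \<bullet> b) \<longlongrightarrow> d \<bullet> b) (at 0)"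
    by (simp add: has_field_derivative_iff inner_diff_left divide_inverse mult.commute)
qed

text \<open>Fermat: the squared distance to \<open>x\<close> is stationary along every curve through a minimum.\<close>

lemma tangent_orthogonal_at_nearest:
  assumes "\<And>y. y \<in> S \<Longrightarrow> dist x q \<le> dist x y" "v \<in> tangent_space S q"
  shows "(x - q) \<bullet> v = 0"
proof -
  obtain \<delta> b where b: "\<delta> > 0" "b ` {-\<delta><..<\<delta>} \<subseteq> S" "b 0 = q"
      "(b has_vector_derivative v) (at 0)"
    using assms(2) unfolding tangent_space_def by blast
  have "((\<lambda>s. x - b s) has_vector_derivative 0 - v) (at 0)"
    by (intro has_vector_derivative_diff has_vector_derivative_const b(4))
  then have "((\<lambda>s. (x - b s) \<bullet> (x - b s)) has_vector_derivative
      (x - b 0) \<bullet> (0 - v) + (0 - v) \<bullet> (x - b 0)) (at 0)"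
    by (intro bounded_bilinear.has_vector_derivative[OF bounded_bilinear_inner])
  then have "DERIV (\<lambda>s. (x - b s) \<bullet> (x - b s)) 0 :> - 2 * ((x - q) \<bullet> v)"
    by (simp add: b(3) inner_commute has_real_derivative_iff_has_vector_derivative)
  moreover have "(x - b 0) \<bullet> (x - b 0) \<le> (x - b s) \<bullet> (x - b s)" if "\<bar>0 - s\<bar> < \<delta>" for s
  proof -
    have "s \<in> {-\<delta><..<\<delta>}" using that by auto
    then have "b s \<in> S" using b(2) by blast
    then show ?thesis
      using assms(1)[of "b s"] b(3) by (simp add: dist_norm norm_le)
  qed
  ultimately have "- 2 * ((x - q) \<bullet> v) = 0"
    using DERIV_local_min[OF _ b(1)] by blast
  then show ?thesis by simp
qed

definition normal_to :: "'a::euclidean_space set \<Rightarrow> 'a \<Rightarrow> 'a \<Rightarrow> bool" where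
  "normal_to K q n \<longleftrightarrow> (\<forall>v\<in>tangent_space K q. n \<bullet> v = 0)"

lemma normal_to_graph_iff:
  assumes "local_graph K \<tau> J c U" "q \<in> U \<inter> K"
  shows "normal_to K q p \<longleftrightarrow> p \<bullet> vector_derivative c (at (q \<bullet> \<tau>)) = 0"
  unfolding normal_to_def by (rule normal_graph_iff[OF assms])

lemma normal_to_scaleR: "normal_to K q n \<Longrightarrow> normal_to K q (k *\<^sub>R n)"
  by (simp add: normal_to_def)

text \<open>Federer's form of positive reach: \<open>K\<close> leaves its tangent lines at most quadratically,
  with a constant that is uniform on \<open>K\<close>. The reach is then at least \<open>1 / (2 * C)\<close>.\<close>

definition reach_bound :: "'a::euclidean_space set \<Rightarrow> real \<Rightarrow> bool" where
  "reach_bound K C \<longleftrightarrow> (\<forall>q\<in>K. \<forall>q'\<in>K. \<forall>n. normal_to K q n \<longrightarrow>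
     \<bar>n \<bullet> (q' - q)\<bar> \<le> C * norm n * (norm (q' - q))\<^sup>2)"

text \<open>The mean value inequality, applied first to \<open>f'\<close> and then to \<open>f\<close>.\<close>

lemma C2_increment_bound:
  fixes f :: "real \<Rightarrow> real"
  assumes "convex I" "a \<in> I" "a' \<in> I"
    and f: "\<And>x. x \<in> I \<Longrightarrow> (f has_real_derivative f' x) (at x)"
    and f': "\<And>x. x \<in> I \<Longrightarrow> (f' has_real_derivative f'' x) (at x)"
    and B: "\<And>x. x \<in> I \<Longrightarrow> \<bar>f'' x\<bar> \<le> B" and "f' a = 0"
  shows "\<bar>f a' - f a\<bar> \<le> B * (a' - a)\<^sup>2"
proof -
  have sub: "closed_segment a a' \<subseteq> I"
    using assms(1-3) by (simp add: closed_segment_subset)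
  have "B \<ge> 0" using B[OF assms(2)] by linarith
  have 1: "\<bar>f' x\<bar> \<le> B * \<bar>a' - a\<bar>" if "x \<in> closed_segment a a'" for x
  proof -
    have "norm (f' x - f' a) \<le> B * norm (x - a)"
      by (rule field_differentiable_bound[OF assms(1), where f' = f''])
        (use sub that assms in \<open>auto intro: has_field_derivative_at_within\<close>)
    moreover have "\<bar>x - a\<bar> \<le> \<bar>a' - a\<bar>"
      using segment_bound(1)[OF that] by simp
    ultimately show ?thesis
      using assms(7) \<open>B \<ge> 0\<close> by (smt (verit) mult_left_mono real_norm_def)
  qed
  have "norm (f a' - f a) \<le> (B * \<bar>a' - a\<bar>) * norm (a' - a)"
    by (rule field_differentiable_bound[where S = "closed_segment a a'" and f' = f'])
      (use 1 sub f in \<open>auto intro: has_field_derivative_at_within\<close>)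
  then show ?thesis
    by (simp add: power2_eq_square mult.assoc abs_mult_self_eq)
qed

text \<open>For normal \<open>n\<close> at \<open>q\<close> the function \<open>n \<bullet> c\<close> is stationary at the parameter of
  \<open>q\<close>, so a bound on \<open>c''\<close> controls its increments quadratically in the parameter, hence in the
  distance of the points.\<close>

lemma reach_bound_local:
  assumes G: "local_graph K \<tau> J c U" and q0: "q0 \<in> U \<inter> K"
  obtains V C where "open V" "q0 \<in> V" "C \<ge> 0"
    "\<And>q q' n. q \<in> V \<inter> K \<Longrightarrow> q' \<in> V \<inter> K \<Longrightarrow> normal_to K q n \<Longrightarrow>
       \<bar>n \<bullet> (q' - q)\<bar> \<le> C * norm n * (norm (q' - q))\<^sup>2"
proof -
  have J: "open J" and c: "C_infinity J c" and \<tau>: "norm \<tau> = 1" and U: "open U"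
    and cU: "\<And>x. x \<in> U \<inter> K \<Longrightarrow> x \<bullet> \<tau> \<in> J \<and> c (x \<bullet> \<tau>) = x"
    using G unfolding local_graph_def by auto
  define d1 where "d1 s = vector_derivative c (at s)" for s
  define d2 where "d2 s = vector_derivative d1 (at s)" for s
  have d1: "C_infinity J d1" and d2: "C_infinity J d2"
    unfolding d2_def d1_def by (intro C_infinity_vector_derivative J c)+
  obtain r where r: "r > 0" "cball (q0 \<bullet> \<tau>) r \<subseteq> J"
    using J cU[OF q0] open_contains_cball by blast
  have "compact (d2 ` cball (q0 \<bullet> \<tau>) r)"
    using C_infinity_continuous_on[OF d2] r(2)
    by (intro compact_continuous_image compact_cball) (rule continuous_on_subset)
  then obtain M where M: "\<And>s. s \<in> cball (q0 \<bullet> \<tau>) r \<Longrightarrow> norm (d2 s) \<le> M"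
    using compact_imp_bounded bounded_iff by (metis imageI)
  have "norm (d2 (q0 \<bullet> \<tau>)) \<le> M"
    by (rule M) (use r(1) in simp)
  then have "M \<ge> 0"
    by (rule order_trans[OF norm_ge_zero])
  define V where "V = U \<inter> (\<lambda>x. x \<bullet> \<tau>) -` ball (q0 \<bullet> \<tau>) r"
  have "open V"
    unfolding V_def using U by (intro open_Int open_vimage continuous_intros) auto
  have "q0 \<in> V" using q0 r by (simp add: V_def)
  have bd: "\<bar>n \<bullet> (q' - q)\<bar> \<le> M * norm n * (norm (q' - q))\<^sup>2"
    if q: "q \<in> V \<inter> K" "q' \<in> V \<inter> K" and n: "normal_to K q n" for q q' n
  proof -
    have dn: "((\<lambda>s. n \<bullet> f s) has_real_derivative n \<bullet> vector_derivative f (at s)) (at s)"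
      if "s \<in> cball (q0 \<bullet> \<tau>) r" "C_infinity J f" for s f
      using bounded_linear.has_vector_derivative[OF bounded_linear_inner_right
          C_infinity_has_vector_derivative[OF that(2)]] that r(2)
      by (auto simp: has_real_derivative_iff_has_vector_derivative)
    have qU: "q \<in> U \<inter> K" "q' \<in> U \<inter> K" using q by (auto simp: V_def)
    have "\<bar>n \<bullet> c (q' \<bullet> \<tau>) - n \<bullet> c (q \<bullet> \<tau>)\<bar> \<le> (norm n * M) * (q' \<bullet> \<tau> - q \<bullet> \<tau>)\<^sup>2"
    proof (rule C2_increment_bound[where I = "cball (q0 \<bullet> \<tau>) r" and f' = "\<lambda>s. n \<bullet> d1 s"
            and f'' = "\<lambda>s. n \<bullet> d2 s"])
      show "\<bar>n \<bullet> d2 x\<bar> \<le> norm n * M" if "x \<in> cball (q0 \<bullet> \<tau>) r" for x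
        using Cauchy_Schwarz_ineq2[of n "d2 x"] M[OF that]
        by (meson mult_left_mono norm_ge_zero order_trans)
      show "n \<bullet> d1 (q \<bullet> \<tau>) = 0"
        using n normal_to_graph_iff[OF G qU(1)] by (simp add: d1_def)
    qed (use q dn[OF _ c] dn[OF _ d1] in \<open>auto simp: V_def d1_def d2_def\<close>)
    moreover have "(q' \<bullet> \<tau> - q \<bullet> \<tau>)\<^sup>2 \<le> (norm (q' - q))\<^sup>2"
      using Cauchy_Schwarz_ineq2[of "q' - q" \<tau>] \<tau>
      using abs_le_square_iff[of "(q' - q) \<bullet> \<tau>" "norm (q' - q)"] by (simp flip: inner_diff_left)
    ultimately show ?thesis
      using cU[OF qU(1)] cU[OF qU(2)] \<open>M \<ge> 0\<close>
      by (smt (verit) inner_diff_right mult.commute mult_left_mono mult_nonneg_nonneg norm_ge_zero)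
  qed
  show thesis
    by (rule that[OF \<open>open V\<close> \<open>q0 \<in> V\<close> \<open>M \<ge> 0\<close> bd])
qed

text \<open>Cover \<open>K\<close> by finitely many neighbourhoods with local bounds, and let \<open>\<epsilon>\<close> be a Lebesgue
  number of the cover. Two points closer than \<open>\<epsilon>\<close> share a neighbourhood, and its constant applies;
  for all others Cauchy-Schwarz gives the bound with \<open>1 / \<epsilon>\<close>.\<close>

lemma reach_bound_exists:
  assumes "compact K" "embedded_curve K"
  obtains C where "C > 0" "reach_bound K C"
proof -
  have "\<exists>V C. open V \<and> q0 \<in> V \<and> C \<ge> 0 \<and>
      (\<forall>q\<in>V \<inter> K. \<forall>q'\<in>V \<inter> K. \<forall>n. normal_to K q n \<longrightarrow>
         \<bar>n \<bullet> (q' - q)\<bar> \<le> C * norm n * (norm (q' - q))\<^sup>2)" if q0: "q0 \<in> K" for q0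
  proof -
    obtain \<tau> J c U where "q0 \<in> U" and G: "local_graph K \<tau> J c U"
      using q0 assms(2) unfolding embedded_curve_def by blast
    with q0 have "q0 \<in> U \<inter> K" by simp
    from reach_bound_local[OF G this] show ?thesis by metis
  qed
  then obtain V C where V: "\<And>q0. q0 \<in> K \<Longrightarrow> open (V q0) \<and> q0 \<in> V q0 \<and> C q0 \<ge> (0::real)"
    and C: "\<And>q0 q q' n. q0 \<in> K \<Longrightarrow> q \<in> V q0 \<inter> K \<Longrightarrow> q' \<in> V q0 \<inter> K \<Longrightarrow> normal_to K q n \<Longrightarrow>
         \<bar>n \<bullet> (q' - q)\<bar> \<le> C q0 * norm n * (norm (q' - q))\<^sup>2"
    by metis
  obtain D where D: "D \<subseteq> K" "finite D" "K \<subseteq> (\<Union>q\<in>D. V q)"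
    by (rule compactE_image[OF assms(1), of K V]) (use V in auto)
  obtain \<epsilon> where \<epsilon>: "0 < \<epsilon>" "\<And>x. x \<in> K \<Longrightarrow> \<exists>G\<in>V ` D. ball x \<epsilon> \<subseteq> G"
    by (rule Heine_Borel_lemma[OF assms(1) D(3)]) (use V D in auto)
  define B where "B = (\<Sum>d\<in>D. C d) + 1 / \<epsilon>"
  have sumC: "C d \<le> (\<Sum>d\<in>D. C d)" if "d \<in> D" for d
    using that D V by (intro member_le_sum) auto
  have "(\<Sum>d\<in>D. C d) \<ge> 0"
    using D V by (intro sum_nonneg) auto
  then have B: "B > 0" "1 / \<epsilon> \<le> B" "\<And>d. d \<in> D \<Longrightarrow> C d \<le> B"
    using \<epsilon>(1) sumC by (auto simp: B_def add_nonneg_pos intro: add_increasing2)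
  have "reach_bound K B"
    unfolding reach_bound_def
  proof (intro ballI allI impI)
    fix q q' n assume q: "q \<in> K" "q' \<in> K" and n: "normal_to K q n"
    show "\<bar>n \<bullet> (q' - q)\<bar> \<le> B * norm n * (norm (q' - q))\<^sup>2"
    proof (cases "dist q q' < \<epsilon>")
      case True
      obtain d where d: "d \<in> D" "ball q \<epsilon> \<subseteq> V d" using \<epsilon>(2)[OF q(1)] by blast
      have "q \<in> V d \<inter> K" "q' \<in> V d \<inter> K" using d(2) q True \<epsilon>(1) by auto
      with d D(1) have "\<bar>n \<bullet> (q' - q)\<bar> \<le> C d * norm n * (norm (q' - q))\<^sup>2"
        using C[of d q q' n] n by auto
      also have "\<dots> \<le> B * norm n * (norm (q' - q))\<^sup>2"
        using B(3)[OF d(1)] by (intro mult_right_mono) auto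
      finally show ?thesis .
    next
      case False
      then have e: "\<epsilon> \<le> norm (q' - q)" by (simp add: dist_norm norm_minus_commute)
      have "\<bar>n \<bullet> (q' - q)\<bar> \<le> norm n * norm (q' - q)"
        by (rule Cauchy_Schwarz_ineq2)
      also have "\<dots> \<le> norm n * ((1 / \<epsilon>) * (norm (q' - q))\<^sup>2)"
        using e \<epsilon>(1) by (intro mult_left_mono) (auto simp: power2_eq_square field_simps mult_right_mono)
      also have "\<dots> \<le> norm n * (B * (norm (q' - q))\<^sup>2)"
        using B(2) by (intro mult_left_mono mult_right_mono) auto
      finally show ?thesis by (simp add: mult_ac)
    qed
  qed
  with B(1) show thesis by (rule that)
qed

lemma reach_boundD:
  "reach_bound K C \<Longrightarrow> q \<in> K \<Longrightarrow> q' \<in> K \<Longrightarrow> normal_to K q n \<Longrightarrow>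
    \<bar>n \<bullet> (q' - q)\<bar> \<le> C * norm n * (norm (q' - q))\<^sup>2"
  unfolding reach_bound_def by blast

text \<open>Expanding \<open>\<bar>q + n - q'\<bar>\<^sup>2\<close>, the reach bound absorbs the cross term \<open>2 n \<bullet> (q' - q)\<close> into
  \<open>\<bar>q' - q\<bar>\<^sup>2\<close>.\<close>

lemma infdist_along_normal:
  assumes R: "reach_bound K C" and q: "q \<in> K" and n: "normal_to K q n" and C: "2 * C * norm n \<le> 1"
  shows "infdist (q + n) K = norm n"
proof (rule antisym)
  show "infdist (q + n) K \<le> norm n"
    using infdist_le[OF q, of "q + n"] by (simp add: dist_norm)
  have "norm n \<le> dist (q + n) q'" if "q' \<in> K" for q'
  proof -
    have "\<bar>n \<bullet> (q' - q)\<bar> \<le> C * norm n * (norm (q' - q))\<^sup>2"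
      by (rule reach_boundD[OF R q that n])
    also have "2 * \<dots> \<le> 1 * (norm (q' - q))\<^sup>2"
      using mult_right_mono[OF C, of "(norm (q' - q))\<^sup>2"] by (simp add: mult_ac)
    finally have "2 * (n \<bullet> (q' - q)) \<le> (q' - q) \<bullet> (q' - q)"
      by (simp add: power2_norm_eq_inner)
    then have "n \<bullet> n \<le> (q + n - q') \<bullet> (q + n - q')"
      by (simp add: inner_diff_left inner_diff_right inner_add_left inner_add_right inner_commute)
    then show ?thesis
      by (simp add: dist_norm norm_le)
  qed
  then show "norm n \<le> infdist (q + n) K"
    using q by (auto simp: infdist_def intro: cINF_greatest)
qed

text \<open>If \<open>2 * C * r < 1\<close>, points of the tube cannot approach each other without their foot points
  doing so: this is what makes the nearest point map Lipschitz.\<close>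

lemma normal_displacement_monotone:
  assumes R: "reach_bound K C" and q: "q \<in> K" "q' \<in> K"
    and n: "normal_to K q n" "normal_to K q' n'" and r: "norm n \<le> r" "norm n' \<le> r" and "C \<ge> 0"
  shows "(1 - 2 * C * r) * (norm (q' - q))\<^sup>2 \<le> (q' - q) \<bullet> ((q' + n') - (q + n))"
proof -
  have "\<bar>n \<bullet> (q' - q)\<bar> \<le> C * norm n * (norm (q' - q))\<^sup>2"
    by (rule reach_boundD[OF R q n(1)])
  also have "\<dots> \<le> C * r * (norm (q' - q))\<^sup>2"
    using r(1) \<open>C \<ge> 0\<close> by (intro mult_right_mono mult_left_mono) auto
  finally have 1: "n \<bullet> (q' - q) \<le> C * r * (norm (q' - q))\<^sup>2" by simp
  have "\<bar>n' \<bullet> (q - q')\<bar> \<le> C * norm n' * (norm (q - q'))\<^sup>2"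
    by (rule reach_boundD[OF R q(2,1) n(2)])
  also have "\<dots> \<le> C * r * (norm (q' - q))\<^sup>2"
    using r(2) \<open>C \<ge> 0\<close> by (simp add: norm_minus_commute) (intro mult_right_mono mult_left_mono; simp)
  finally have 2: "- (n' \<bullet> (q' - q)) \<le> C * r * (norm (q' - q))\<^sup>2"
    by (simp add: inner_diff_right)
  have "(q' - q) \<bullet> ((q' + n') - (q + n)) = (norm (q' - q))\<^sup>2 + n' \<bullet> (q' - q) - n \<bullet> (q' - q)"
    by (simp add: power2_norm_eq_inner inner_diff_left inner_diff_right inner_add_left inner_add_right
        inner_commute)
  with 1 2 show ?thesis by (simp add: algebra_simps)
qed

lemma nearest_point_decomposition:
  assumes "compact K" "K \<noteq> {}"
  obtains q where "q \<in> K" "normal_to K q (x - q)" "norm (x - q) = infdist x K"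
proof -
  obtain q where q: "q \<in> K" "infdist x K = dist x q"
    using infdist_attains_inf[OF compact_imp_closed[OF assms(1)] assms(2)] by blast
  have "normal_to K q (x - q)"
    unfolding normal_to_def
    using tangent_orthogonal_at_nearest[of K x q] q infdist_le[of _ K x] by auto
  with q that show thesis by (simp add: dist_norm)
qed

text \<open>A nearest point of \<open>K\<close> is the foot of a normal vector, so every point close to \<open>K\<close> lies on
  a short normal segment.\<close>

lemma tubular_nbhd_eq:
  assumes "compact K" "K \<noteq> {}"
  shows "tubular_nbhd K \<epsilon> = {x. infdist x K \<le> \<epsilon>}"
proof (intro equalityI subsetI)
  fix x assume "x \<in> tubular_nbhd K \<epsilon>"
  then obtain q v where "x = q + v" "q \<in> K" "norm v \<le> \<epsilon>"
    unfolding tubular_nbhd_def by blast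
  then show "x \<in> {x. infdist x K \<le> \<epsilon>}"
    using infdist_le[of q K x] by (auto simp: dist_norm)
next
  fix x assume x: "x \<in> {x. infdist x K \<le> \<epsilon>}"
  obtain q where "q \<in> K" "normal_to K q (x - q)" "norm (x - q) = infdist x K"
    by (rule nearest_point_decomposition[OF assms])
  with x have "x = q + (x - q) \<and> q \<in> K \<and> norm (x - q) \<le> \<epsilon> \<and>
      (\<forall>w\<in>tangent_space K q. (x - q) \<bullet> w = 0)"
    by (simp add: normal_to_def)
  then show "x \<in> tubular_nbhd K \<epsilon>"
    unfolding tubular_nbhd_def by blast
qed

lemma infdist_less_interior_tube:
  assumes "compact K" "K \<noteq> {}" "infdist x K < \<epsilon>"
  shows "x \<in> interior (tubular_nbhd K \<epsilon>)"
proof (rule interiorI)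
  show "open {x. infdist x K < \<epsilon>}"
    by (intro open_Collect_less continuous_intros)
qed (use assms in \<open>auto simp: tubular_nbhd_eq\<close>)

lemma infdist_exceeds_along_normal:
  assumes R: "reach_bound K C" and q: "q \<in> K" and n: "normal_to K q n" and "norm n = r"
    and r: "0 < r" "2 * C * r < 1"
  shows "\<exists>\<delta>>0. \<forall>t. 0 < t \<and> t < \<delta> \<longrightarrow> infdist (q + (1 + t) *\<^sub>R n) K > r"
proof -
  have "((\<lambda>t. 2 * C * ((1 + t) * r)) \<longlongrightarrow> 2 * C * ((1 + 0) * r)) (at_right 0)"
    by (intro tendsto_intros)
  then have "\<forall>\<^sub>F t in at_right 0. 2 * C * ((1 + t) * r) < 1"
    using r(2) by (intro order_tendstoD(2)) auto
  then obtain \<delta> where \<delta>: "\<delta> > 0" "\<And>t. 0 < t \<Longrightarrow> t < \<delta> \<Longrightarrow> 2 * C * ((1 + t) * r) < 1"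
    unfolding eventually_at_right_field by blast
  have "infdist (q + (1 + t) *\<^sub>R n) K > r" if t: "0 < t" "t < \<delta>" for t
  proof -
    have nrm: "norm ((1 + t) *\<^sub>R n) = (1 + t) * r" using t assms(4) by simp
    have "infdist (q + (1 + t) *\<^sub>R n) K = (1 + t) * r"
      using infdist_along_normal[OF R q normal_to_scaleR[OF n], of "1 + t"] \<delta>(2)[OF t] nrm by simp
    then show ?thesis using t r by (simp add: algebra_simps)
  qed
  with \<delta>(1) show ?thesis by blast
qed

text \<open>Points at distance exactly \<open>r\<close> are limits of points further away, obtained by prolonging the
  normal segment; this needs some room below the reach.\<close>

lemma boundary_torus_eq:
  assumes K: "compact K" "K \<noteq> {}" and R: "reach_bound K C" and r: "0 < r" "2 * C * r < 1"
  shows "boundary_torus K r = {x. infdist x K = r}"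
proof -
  have "closed {x. infdist x K \<le> r}"
    by (intro closed_Collect_le continuous_intros)
  then have fr: "boundary_torus K r = {x. infdist x K \<le> r} - interior (tubular_nbhd K r)"
    unfolding boundary_torus_def frontier_def by (simp add: tubular_nbhd_eq[OF K] closure_closed)
  have "x \<notin> interior (tubular_nbhd K r)" if x: "infdist x K = r" for x
  proof
    assume "x \<in> interior (tubular_nbhd K r)"
    then obtain e where e: "e > 0" "ball x e \<subseteq> {x. infdist x K \<le> r}"
      unfolding tubular_nbhd_eq[OF K] mem_interior by blast
    obtain q where q: "q \<in> K" "normal_to K q (x - q)" "norm (x - q) = r"
      using nearest_point_decomposition[OF K] x by metis
    obtain \<delta> where \<delta>: "\<delta> > 0" "\<And>t. 0 < t \<Longrightarrow> t < \<delta> \<Longrightarrow> infdist (q + (1 + t) *\<^sub>R (x - q)) K > r"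
      using infdist_exceeds_along_normal[OF R q r] by blast
    define t where "t = min (\<delta> / 2) (e / (2 * r))"
    have t: "0 < t" "t < \<delta>" "t * r < e"
      using \<delta>(1) e(1) r(1) by (auto simp: t_def min_def field_simps)
    have "dist x (q + (1 + t) *\<^sub>R (x - q)) = norm (t *\<^sub>R (x - q))"
      by (simp add: dist_norm algebra_simps norm_minus_commute)
    also have "\<dots> < e" using t q(3) by simp
    finally have "infdist (q + (1 + t) *\<^sub>R (x - q)) K \<le> r"
      using e(2) by auto
    with \<delta>(2)[OF t(1,2)] show False by simp
  qed
  with fr infdist_less_interior_tube[OF K, of _ r] show ?thesis
    by (auto simp: order.order_iff_strict)
qed

section \<open>The inward conormal of a distance torus\<close>

text \<open>Curves in the level set are built from a curve of foot points and a field of normals, rescaled to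
  length \<open>r\<close>.\<close>

lemma tangent_to_distance_level:
  assumes R: "reach_bound K C" and r: "0 < r" "2 * C * r < 1" and "\<delta> > 0"
    and b: "C_infinity {-\<delta><..<\<delta>} b" and N: "C_infinity {-\<delta><..<\<delta>} N"
    and bK: "\<And>s. s \<in> {-\<delta><..<\<delta>} \<Longrightarrow> b s \<in> K \<and> normal_to K (b s) (N s) \<and> N s \<noteq> 0"
    and d: "((\<lambda>s. b s + (r / norm (N s)) *\<^sub>R N s) has_vector_derivative y) (at 0)"
    and x: "x = b 0 + (r / norm (N 0)) *\<^sub>R N 0"
  shows "y \<in> tangent_space {x. infdist x K = r} x"
proof -
  have "C_infinity {-\<delta><..<\<delta>} (\<lambda>s. b s + (r * inverse (norm (N s))) *\<^sub>R N s)"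
    by (intro C_infinity_add C_infinity_scaleR C_infinity_mult C_infinity_const C_infinity_inverse
        C_infinity_norm b N open_greaterThanLessThan) (use bK in auto)
  then have "smooth_on {-\<delta><..<\<delta>} (\<lambda>s. b s + (r / norm (N s)) *\<^sub>R N s)"
    by (simp add: smooth_on_open_iff divide_inverse)
  moreover have "infdist (b s + (r / norm (N s)) *\<^sub>R N s) K = r" if "s \<in> {-\<delta><..<\<delta>}" for s
    using infdist_along_normal[OF R, of "b s" "(r / norm (N s)) *\<^sub>R N s"] bK[OF that] r
    by (simp add: normal_to_scaleR)
  ultimately show ?thesis
    unfolding tangent_space_def using \<open>\<delta> > 0\<close> d x
    by (auto intro!: exI[of _ \<delta>] exI[of _ "\<lambda>s. b s + (r / norm (N s)) *\<^sub>R N s"])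
qed

text \<open>The meridian direction: rotate the normal vector \<open>v\<close> inside the normal space at \<open>q\<close>.\<close>

lemma meridian_tangent:
  assumes R: "reach_bound K C" and r: "0 < r" "2 * C * r < 1"
    and q: "q \<in> K" and v: "normal_to K q v" "norm v = r" and w: "normal_to K q w" "w \<bullet> v = 0"
  shows "w \<in> tangent_space {x. infdist x K = r} (q + v)"
proof (rule tangent_to_distance_level[OF R r, where \<delta> = 1 and b = "\<lambda>s. q" and N = "\<lambda>s. v + s *\<^sub>R w"])
  have sq: "(norm (v + s *\<^sub>R w))\<^sup>2 = r\<^sup>2 + s\<^sup>2 * (norm w)\<^sup>2" for s
    unfolding v(2)[symmetric] power2_norm_eq_inner using w(2)
    by (simp add: inner_add_left inner_add_right inner_commute[of v w] power2_eq_square)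
  then have nrm: "norm (v + s *\<^sub>R w) = sqrt (r\<^sup>2 + s\<^sup>2 * (norm w)\<^sup>2)" for s
    by (metis norm_ge_zero real_sqrt_unique)
  show "C_infinity {-1<..<1} (\<lambda>s::real. v + s *\<^sub>R w)"
    by (intro C_infinity_add C_infinity_scaleR C_infinity_id) auto
  show "q \<in> K \<and> normal_to K q (v + s *\<^sub>R w) \<and> v + s *\<^sub>R w \<noteq> 0" for s
  proof -
    have "r\<^sup>2 + s\<^sup>2 * (norm w)\<^sup>2 > 0"
      using r(1) by (intro add_pos_nonneg) auto
    then have "v + s *\<^sub>R w \<noteq> 0"
      using sq[of s] by auto
    then show ?thesis
      using q v(1) w(1) by (simp add: normal_to_def inner_add_left)
  qed
  have "((\<lambda>s. r / sqrt (r\<^sup>2 + s\<^sup>2 * (norm w)\<^sup>2)) has_real_derivative 0) (at 0)"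
    using r(1) by (auto intro!: derivative_eq_intros)
  then have "((\<lambda>s. r / norm (v + s *\<^sub>R w)) has_real_derivative 0) (at 0)"
    by (simp add: nrm)
  moreover have "((\<lambda>s. v + s *\<^sub>R w) has_vector_derivative w) (at 0)"
    by (auto intro!: derivative_eq_intros)
  ultimately have "((\<lambda>s. (r / norm (v + s *\<^sub>R w)) *\<^sub>R (v + s *\<^sub>R w)) has_vector_derivative
      (r / norm (v + 0 *\<^sub>R w)) *\<^sub>R w + 0 *\<^sub>R (v + 0 *\<^sub>R w)) (at 0)"
    by (rule has_vector_derivative_scaleR)
  then have "((\<lambda>s. q + (r / norm (v + s *\<^sub>R w)) *\<^sub>R (v + s *\<^sub>R w)) has_vector_derivative
      0 + ((r / norm (v + 0 *\<^sub>R w)) *\<^sub>R w + 0 *\<^sub>R (v + 0 *\<^sub>R w))) (at 0)"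
    by (intro has_vector_derivative_add has_vector_derivative_const)
  then show "((\<lambda>s. q + (r / norm (v + s *\<^sub>R w)) *\<^sub>R (v + s *\<^sub>R w)) has_vector_derivative w) (at 0)"
    using v(2) r(1) by simp
qed (use v r in auto)

text \<open>The longitude direction: push \<open>v\<close> along \<open>K\<close> by orthogonal projection to the normal spaces.
  The velocity is not computed; that it has a positive component along \<open>K\<close> follows from
  \<open>normal_displacement_monotone\<close> by dividing by \<open>s\<^sup>2\<close> and letting \<open>s\<close> tend to 0.\<close>

lemma longitude_tangent:
  assumes G: "local_graph K \<tau> J c U" and q: "q \<in> U \<inter> K"
    and R: "reach_bound K C" "C \<ge> 0" and r: "0 < r" "2 * C * r < 1"
    and v: "normal_to K q v" "norm v = r"
  obtains y where "y \<in> tangent_space {x. infdist x K = r} (q + v)"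
    "y \<bullet> vector_derivative c (at (q \<bullet> \<tau>)) > 0"
proof -
  define a where "a = q \<bullet> \<tau>"
  have J: "open J" "a \<in> J" "c a = q" and c: "C_infinity J c" and U: "open U"
    and cJ: "\<And>s. s \<in> J \<Longrightarrow> c s \<in> K \<and> c s \<bullet> \<tau> = s"
    and cU: "\<And>x. x \<in> U \<inter> K \<Longrightarrow> x \<bullet> \<tau> \<in> J \<and> c (x \<bullet> \<tau>) = x"
    using G q unfolding local_graph_def a_def by auto
  define d where "d s = vector_derivative c (at s)" for s
  define b where "b s = c (a + s)" for s
  define D where "D s = d (a + s)" for s
  define N where "N s = v - ((v \<bullet> D s) * inverse (D s \<bullet> D s)) *\<^sub>R D s" for s
  have va: "v \<bullet> D 0 = 0"
    using v(1) normal_to_graph_iff[OF G q] by (simp add: D_def d_def a_def)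
  then have N0: "N 0 = v" by (simp add: N_def)
  define I where "I = (\<lambda>s. a + s) -` (J \<inter> c -` U)"
  have oJ: "open (J \<inter> c -` U)"
    using C_infinity_continuous_on[OF c] J(1) U by (metis continuous_on_open_vimage inf_commute)
  have I: "open I" "0 \<in> I"
  proof -
    show "open I"
      unfolding I_def by (rule open_vimage[OF oJ]) (intro continuous_intros)
    show "0 \<in> I"
      using J q by (simp add: I_def)
  qed
  have sh: "C_infinity I (\<lambda>s. a + s)"
    using I(1) by (intro C_infinity_add C_infinity_const C_infinity_id)
  have shI: "(\<lambda>s. a + s) ` I \<subseteq> J" by (auto simp: I_def)
  have b: "C_infinity I b" and D: "C_infinity I D"
    unfolding b_def D_def d_def
    using C_infinity_vector_derivative[OF J(1) c]
    by (auto intro: C_infinity_compose[OF I(1) J(1) shI sh] c)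
  have D0: "D s \<bullet> D s > 0" if "s \<in> I" for s
  proof -
    have "D s \<bullet> \<tau> = 1"
      unfolding D_def d_def by (rule graph_derivative_inner[OF G]) (use that shI in auto)
    then show ?thesis by auto
  qed
  have N: "C_infinity I N"
    unfolding N_def
    by (intro C_infinity_diff C_infinity_scaleR C_infinity_mult C_infinity_inner C_infinity_inverse
        C_infinity_const D D0 I(1))
  have bN: "b s \<in> K \<and> normal_to K (b s) (N s)" if "s \<in> I" for s
  proof -
    have s: "a + s \<in> J" "b s \<in> U \<inter> K" "b s \<bullet> \<tau> = a + s"
      using that cJ by (auto simp: I_def b_def)
    have "N s \<bullet> D s = 0"
      using D0[OF that] by (simp add: N_def inner_diff_left)
    then have "normal_to K (b s) (N s)"
      using normal_to_graph_iff[OF G s(2)] s(3) by (simp add: D_def d_def)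
    with s(2) show ?thesis by simp
  qed
  have "open (I \<inter> N -` (- {0}))"
    using C_infinity_continuous_on[OF N] I(1)
    by (metis closed_singleton continuous_on_open_vimage inf_commute open_Compl)
  moreover have "0 \<in> I \<inter> N -` (- {0})"
    using I(2) N0 v(2) r(1) by auto
  ultimately obtain \<delta> where \<delta>: "\<delta> > 0" "{-\<delta><..<\<delta>} \<subseteq> I \<inter> N -` (- {0})"
    using openE by (metis (no_types, lifting) add.left_neutral ball_eq_greaterThanLessThan diff_0)
  define X where "X s = b s + (r / norm (N s)) *\<^sub>R N s" for s
  have smX: "C_infinity {-\<delta><..<\<delta>} (\<lambda>s. b s + (r * inverse (norm (N s))) *\<^sub>R N s)"
    using \<delta>(2) C_infinity_subset[OF b] C_infinity_subset[OF N]
    by (intro C_infinity_add C_infinity_scaleR C_infinity_mult C_infinity_const C_infinity_inverse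
        C_infinity_norm open_greaterThanLessThan) auto
  define y where "y = vector_derivative X (at 0)"
  have X: "(X has_vector_derivative y) (at 0)"
    using C_infinity_has_vector_derivative[OF smX, of 0] \<delta>(1)
    by (simp add: X_def[abs_def] y_def divide_inverse)
  have X0: "X 0 = q + v"
    using v(2) r(1) N0 J(3) by (simp add: X_def b_def)
  have y: "y \<in> tangent_space {x. infdist x K = r} (q + v)"
  proof (rule tangent_to_distance_level[OF R(1) r \<delta>(1)])
    show "C_infinity {-\<delta><..<\<delta>} b" "C_infinity {-\<delta><..<\<delta>} N"
      using \<delta>(2) C_infinity_subset b N by blast+
    show "((\<lambda>s. b s + (r / norm (N s)) *\<^sub>R N s) has_vector_derivative y) (at 0)"
      using X by (simp add: X_def[abs_def])
    show "q + v = b 0 + (r / norm (N 0)) *\<^sub>R N 0"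
      using X0 by (simp add: X_def)
  qed (use \<delta>(2) bN in auto)
  have db: "(b has_vector_derivative D 0) (at 0)"
  proof -
    have "(c has_vector_derivative D 0) (at (a + 0))"
      unfolding D_def d_def using C_infinity_has_vector_derivative[OF c] J(2) by simp
    moreover have "((\<lambda>s. a + s) has_vector_derivative 1) (at 0)"
      by (auto intro!: derivative_eq_intros)
    ultimately show ?thesis
      using vector_diff_chain_at[of "\<lambda>s. a + s" 1 0 c "D 0"] by (simp add: b_def[abs_def] comp_def)
  qed
  define \<kappa> where "\<kappa> = 1 - 2 * C * r"
  have mono: "\<kappa> * (norm (b s - b 0))\<^sup>2 \<le> (b s - b 0) \<bullet> (X s - X 0)" if "s \<in> {-\<delta><..<\<delta>}" for s
  proof -
    have s: "s \<in> I" "N s \<noteq> 0" using that \<delta>(2) by auto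
    show ?thesis
      unfolding \<kappa>_def X_def
      by (rule normal_displacement_monotone[OF R(1)])
        (use bN[OF s(1)] bN[OF I(2)] s(2) N0 v r R(2) in \<open>auto intro: normal_to_scaleR\<close>)
  qed
  have qb: "((\<lambda>s. (b s - b 0) /\<^sub>R s) \<longlongrightarrow> D 0) (at 0)"
    and qX: "((\<lambda>s. (X s - X 0) /\<^sub>R s) \<longlongrightarrow> y) (at 0)"
    by (rule has_vector_derivative_quotient[OF db] has_vector_derivative_quotient[OF X])+
  have "\<kappa> * (norm (D 0))\<^sup>2 \<le> D 0 \<bullet> y"
  proof (rule tendsto_le)
    show "((\<lambda>s. \<kappa> * (norm ((b s - b 0) /\<^sub>R s))\<^sup>2) \<longlongrightarrow> \<kappa> * (norm (D 0))\<^sup>2) (at 0)"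
      by (intro tendsto_intros qb)
    show "((\<lambda>s. ((b s - b 0) /\<^sub>R s) \<bullet> ((X s - X 0) /\<^sub>R s)) \<longlongrightarrow> D 0 \<bullet> y) (at 0)"
      by (intro tendsto_intros qb qX)
    have "\<forall>\<^sub>F s in at 0. s \<in> {-\<delta><..<\<delta>} \<and> s \<noteq> (0::real)"
      using \<delta>(1) by (intro eventually_conj eventually_at_in_open' eventually_neq_at_within) auto
    then show "\<forall>\<^sub>F s in at 0. \<kappa> * (norm ((b s - b 0) /\<^sub>R s))\<^sup>2
        \<le> ((b s - b 0) /\<^sub>R s) \<bullet> ((X s - X 0) /\<^sub>R s)"
    proof eventually_elim
      case (elim s)
      then have "(\<kappa> * (norm (b s - b 0))\<^sup>2) / s\<^sup>2 \<le> ((b s - b 0) \<bullet> (X s - X 0)) / s\<^sup>2"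
        using mono by (intro divide_right_mono) auto
      with elim show ?case
        by (simp add: power2_eq_square divide_simps)
    qed
  qed simp
  moreover have "\<kappa> * (norm (D 0))\<^sup>2 > 0"
    using r(2) D0[OF I(2)] by (auto simp: \<kappa>_def)
  ultimately have "y \<bullet> D 0 > 0"
    by (simp add: inner_commute)
  with y show thesis
    by (intro that[of y]) (auto simp: D_def d_def a_def)
qed

text \<open>The level set stays outside the ball of radius \<open>r\<close> about \<open>q\<close> and touches it at
  \<open>q + v\<close>, so its tangent vectors are orthogonal to \<open>v\<close>; meridian and longitude vectors
  together span that hyperplane.\<close>

lemma conormal_of_distance_level:
  assumes K: "embedded_curve K" and R: "reach_bound K C" "C \<ge> 0" and r: "0 < r" "2 * C * r < 1"
    and q: "q \<in> K" and v: "normal_to K q v" "norm v = r"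
  shows "normal_to {x. infdist x K = r} (q + v) p \<longleftrightarrow> (\<exists>k. p = k *\<^sub>R v)"
proof
  have vt: "v \<bullet> y = 0" if "y \<in> tangent_space {x. infdist x K = r} (q + v)" for y
  proof -
    have "dist q (q + v) \<le> dist q x" if "infdist x K = r" for x
      using infdist_le[OF q, of x] that v(2) by (simp add: dist_norm norm_minus_commute)
    then have "(q - (q + v)) \<bullet> y = 0"
      using that by (intro tangent_orthogonal_at_nearest) auto
    then show ?thesis by simp
  qed
  then show "\<exists>k. p = k *\<^sub>R v \<Longrightarrow> normal_to {x. infdist x K = r} (q + v) p"
    by (auto simp: normal_to_def)
  assume p: "normal_to {x. infdist x K = r} (q + v) p"
  obtain \<tau> J c U where "q \<in> U" and G: "local_graph K \<tau> J c U"
    using K q unfolding embedded_curve_def by blast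
  then have qU: "q \<in> U \<inter> K" using q by blast
  define D where "D = vector_derivative c (at (q \<bullet> \<tau>))"
  have "D \<bullet> \<tau> = 1"
    unfolding D_def by (rule graph_derivative_inner[OF G]) (use G qU in \<open>auto simp: local_graph_def\<close>)
  then have D: "D \<bullet> D \<noteq> 0" by auto
  have vD: "v \<bullet> D = 0" "D \<bullet> v = 0"
    using v(1) normal_to_graph_iff[OF G qU] by (simp_all add: D_def inner_commute)
  have vv: "v \<bullet> v \<noteq> 0" using v(2) r(1) by auto
  define \<alpha> where "\<alpha> = (p \<bullet> v) / (v \<bullet> v)"
  define \<beta> where "\<beta> = (p \<bullet> D) / (D \<bullet> D)"
  define w where "w = p - \<alpha> *\<^sub>R v - \<beta> *\<^sub>R D"
  have w: "w \<bullet> v = 0" "w \<bullet> D = 0"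
    using vD vv D by (simp_all add: w_def \<alpha>_def \<beta>_def inner_diff_left)
  have "w \<in> tangent_space {x. infdist x K = r} (q + v)"
    by (rule meridian_tangent[OF R(1) r q v _ w(1)])
      (use w(2) normal_to_graph_iff[OF G qU] in \<open>simp add: D_def\<close>)
  then have "p \<bullet> w = 0" using p by (simp add: normal_to_def)
  moreover have pw: "p = w + \<alpha> *\<^sub>R v + \<beta> *\<^sub>R D" by (simp add: w_def)
  ultimately have "w \<bullet> w = 0"
    using w by (metis add.right_neutral inner_add_left inner_commute inner_scaleR_left mult_zero_right)
  then have "w = 0" by simp
  with pw have pe: "p = \<alpha> *\<^sub>R v + \<beta> *\<^sub>R D" by simp
  obtain y where y: "y \<in> tangent_space {x. infdist x K = r} (q + v)" "y \<bullet> D > 0"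
    using longitude_tangent[OF G qU R r v] by (auto simp: D_def)
  have "p \<bullet> y = 0" using p y(1) by (simp add: normal_to_def)
  then have "\<beta> * (D \<bullet> y) = 0"
    using vt[OF y(1)] by (simp add: pe inner_add_left)
  then have "\<beta> = 0" using y(2) by (auto simp: inner_commute)
  with pe show "\<exists>k. p = k *\<^sub>R v" by auto
qed

text \<open>Of the two unit conormals at \<open>q + v\<close>, the outward one \<open>v / r\<close> leaves the tube at once because the
  distance to \<open>K\<close> grows along it.\<close>

lemma inward_conormal_eq:
  assumes K: "compact K" "K \<noteq> {}" "embedded_curve K" and R: "reach_bound K C" "C \<ge> 0"
    and r: "0 < r" "2 * C * r < 1"
  shows "inward_conormal K r = (\<lambda>(q, p). (q - r *\<^sub>R p, p)) ` unit_conormal K"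
proof (intro equalityI subsetI)
  note B = boundary_torus_eq[OF K(1,2) R(1) r]
  fix z assume "z \<in> inward_conormal K r"
  then obtain x p where z: "z = (x, p)" and p: "norm p = 1" and x: "infdist x K = r"
    and n: "normal_to {x. infdist x K = r} x p"
    and inw: "\<exists>\<delta>>0. \<forall>t. 0 < t \<and> t < \<delta> \<longrightarrow> x + t *\<^sub>R p \<in> interior (tubular_nbhd K r)"
    unfolding inward_conormal_def unit_conormal_def unit_cotangent_def B normal_to_def by auto
  obtain q where q: "q \<in> K" "normal_to K q (x - q)" "norm (x - q) = r"
    using nearest_point_decomposition[OF K(1,2)] x by metis
  define v where "v = x - q"
  have v: "normal_to K q v" "norm v = r" "x = q + v" using q by (auto simp: v_def)
  obtain k where k: "p = k *\<^sub>R v"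
    using conormal_of_distance_level[OF K(3) R r q(1) v(1,2)] n v(3) by auto
  have "\<bar>k\<bar> * r = 1" using p k v(2) by simp
  have "\<not> k > 0"
  proof
    assume "k > 0"
    obtain \<delta>1 where \<delta>1: "\<delta>1 > 0" "\<And>t. 0 < t \<Longrightarrow> t < \<delta>1 \<Longrightarrow> infdist (q + (1 + t) *\<^sub>R v) K > r"
      using infdist_exceeds_along_normal[OF R(1) q(1) v(1,2) r] by blast
    obtain \<delta>2 where \<delta>2: "\<delta>2 > 0" "\<And>t. 0 < t \<Longrightarrow> t < \<delta>2 \<Longrightarrow> x + t *\<^sub>R p \<in> interior (tubular_nbhd K r)"
      using inw by blast
    \<comment> \<open>moving by \<open>t\<close> along \<open>p = k v\<close> scales the normal vector by \<open>1 + t k\<close>\<close>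
    define t where "t = min (\<delta>1 / k) \<delta>2 / 2"
    have t: "0 < t" "t < \<delta>2" "t < \<delta>1 / k"
      using \<delta>1(1) \<delta>2(1) \<open>k > 0\<close> by (auto simp: t_def min_def field_simps)
    have "infdist (x + t *\<^sub>R p) K \<le> r"
      using \<delta>2(2)[OF t(1,2)] interior_subset tubular_nbhd_eq[OF K(1,2)] by blast
    moreover have "x + t *\<^sub>R p = q + (1 + t * k) *\<^sub>R v"
      by (simp add: v(3) k algebra_simps)
    ultimately show False
      using \<delta>1(2)[of "t * k"] t \<open>k > 0\<close> by (simp add: pos_less_divide_eq)
  qed
  with \<open>\<bar>k\<bar> * r = 1\<close> have "k * r = -1" by auto
  then have "x = q - r *\<^sub>R p" by (simp add: v(3) k mult.commute)
  moreover have "normal_to K q p" unfolding k by (rule normal_to_scaleR[OF v(1)])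
  ultimately show "z \<in> (\<lambda>(q, p). (q - r *\<^sub>R p, p)) ` unit_conormal K"
    using z p q(1)
    by (auto simp: unit_conormal_def unit_cotangent_def normal_to_def intro!: image_eqI[where x = "(q, p)"])
next
  note B = boundary_torus_eq[OF K(1,2) R(1) r]
  fix z assume "z \<in> (\<lambda>(q, p). (q - r *\<^sub>R p, p)) ` unit_conormal K"
  then obtain q p where z: "z = (q - r *\<^sub>R p, p)" and q: "q \<in> K" and p: "normal_to K q p" "norm p = 1"
    by (auto simp: unit_conormal_def unit_cotangent_def normal_to_def)
  define v where "v = - r *\<^sub>R p"
  have v: "normal_to K q v" "norm v = r" "q - r *\<^sub>R p = q + v"
    using normal_to_scaleR[OF p(1), of "- r"] p(2) r(1) by (auto simp: v_def)
  have "infdist (q + v) K = r"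
    using infdist_along_normal[OF R(1) q v(1)] v(2) r by simp
  moreover have "p = (- 1 / r) *\<^sub>R v" using r(1) by (simp add: v_def)
  then have "normal_to {x. infdist x K = r} (q + v) p"
    using conormal_of_distance_level[OF K(3) R r q v(1,2)] by blast
  moreover have "q + v + t *\<^sub>R p \<in> interior (tubular_nbhd K r)" if t: "0 < t" "t < r" for t
  proof (rule infdist_less_interior_tube[OF K(1,2)])
    have "infdist (q + v + t *\<^sub>R p) K \<le> norm ((t - r) *\<^sub>R p)"
      using infdist_le[OF q, of "q + v + t *\<^sub>R p"] by (simp add: dist_norm v_def algebra_simps)
    then show "infdist (q + v + t *\<^sub>R p) K < r" using p(2) t by simp
  qed
  ultimately show "z \<in> inward_conormal K r"
    using r(1) p(2) unfolding inward_conormal_def unit_conormal_def unit_cotangent_def B normal_to_def z v(3)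
    by auto
qed

section \<open>The unit conormal bundle of a curve as a Legendrian submanifold\<close>

lemma dim_line_times_orthogonal:
  fixes \<tau> e :: "real^3"
  assumes "\<tau> \<noteq> 0" "e \<noteq> 0" "\<tau> \<bullet> e = 0"
  shows "subspace (span {\<tau>} \<times> {z. z \<bullet> \<tau> = 0 \<and> z \<bullet> e = 0})"
    and "dim (span {\<tau>} \<times> {z. z \<bullet> \<tau> = 0 \<and> z \<bullet> e = 0}) = 2"
proof -
  have s: "subspace {z. z \<bullet> \<tau> = 0 \<and> z \<bullet> e = 0}"
    by (auto simp: subspace_def inner_add_left)
  have "\<tau> \<noteq> e" using assms by auto
  then have "independent {\<tau>, e}"
    using assms
    by (intro pairwise_orthogonal_independent) (auto simp: pairwise_def orthogonal_def inner_commute)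
  then have "dim {\<tau>, e} = 2"
    using \<open>\<tau> \<noteq> e\<close> by (simp add: dim_eq_card_independent)
  moreover have "dim {y \<in> UNIV. \<forall>x\<in>span {\<tau>, e}. orthogonal x y} + dim (span {\<tau>, e}) = dim (UNIV :: (real^3) set)"
    by (intro dim_subspace_orthogonal_to_vectors) auto
  moreover have "{y \<in> UNIV. \<forall>x\<in>span {\<tau>, e}. orthogonal x y} = {z. z \<bullet> \<tau> = 0 \<and> z \<bullet> e = 0}"
  proof (intro equalityI subsetI)
    fix y assume y: "y \<in> {z. z \<bullet> \<tau> = 0 \<and> z \<bullet> e = 0}"
    have "orthogonal y x" if "x \<in> span {\<tau>, e}" for x
      by (rule orthogonal_to_span[OF that]) (use y in \<open>auto simp: orthogonal_def\<close>)
    then show "y \<in> {y \<in> UNIV. \<forall>x\<in>span {\<tau>, e}. orthogonal x y}"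
      by (auto simp: orthogonal_commute)
  qed (auto simp: orthogonal_def inner_commute span_base)
  ultimately have "dim {z. z \<bullet> \<tau> = 0 \<and> z \<bullet> e = 0} = 1"
    by simp
  moreover have "dim (span {\<tau>}) = 1"
    using assms(1) by (simp add: dim_span)
  ultimately show "dim (span {\<tau>} \<times> {z. z \<bullet> \<tau> = 0 \<and> z \<bullet> e = 0}) = 2"
    using s by (simp add: dim_Times)
  show "subspace (span {\<tau>} \<times> {z. z \<bullet> \<tau> = 0 \<and> z \<bullet> e = 0})"
    using s by (intro subspace_Times) auto
qed

text \<open>A straightening chart with an explicit inverse. In the base, the curve \<open>c\<close> is sheared onto the
  line along \<open>\<tau>\<close>. In the fibre, the shear \<open>p \<mapsto> p + (p \<bullet> c' - p \<bullet> \<tau>) \<tau>\<close> turns the condition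
  \<open>p \<bullet> c' = 0\<close> into orthogonality to \<open>\<tau>\<close>; rays become points by scaling the component along \<open>e\<close>
  to 1, and that component then records the norm.\<close>

lemma unit_conormal_chart:
  fixes K :: "R3 set"
  assumes G: "local_graph K \<tau> J c U" and e: "norm e = 1" "\<tau> \<bullet> e = 0"
  defines "O' \<equiv> {z. fst z \<in> U \<and> fst z \<bullet> \<tau> \<in> J \<and> snd z \<bullet> e > 0}"
  obtains V \<phi> where "open O'" "open V" "diffeomorphism O' V \<phi>"
    "\<phi> ` (O' \<inter> unit_conormal K) = V \<inter> (span {\<tau>} \<times> {z. z \<bullet> \<tau> = 0 \<and> z \<bullet> e = 0})"
proof -
  have J: "open J" and c: "C_infinity J c" and U: "open U" and \<tau>: "\<tau> \<bullet> \<tau> = 1"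
    and cJ: "\<And>s. s \<in> J \<Longrightarrow> c s \<in> K \<and> c s \<bullet> \<tau> = s"
    and cU: "\<And>x. x \<in> U \<inter> K \<Longrightarrow> x \<bullet> \<tau> \<in> J \<and> c (x \<bullet> \<tau>) = x"
    using G unfolding local_graph_def by (auto simp: norm_eq_1)
  have ee: "e \<bullet> e = 1" "e \<bullet> \<tau> = 0" using e by (auto simp: norm_eq_1 inner_commute)
  define D where "D s = vector_derivative c (at s)" for s
  have D: "C_infinity J D"
    unfolding D_def by (rule C_infinity_vector_derivative[OF J c])
  have D\<tau>: "\<tau> \<bullet> D s = 1" if "s \<in> J" for s
    unfolding D_def using graph_derivative_inner[OF G that] by (simp add: inner_commute)
  define f1 where "f1 z = fst z - c (fst z \<bullet> \<tau>) + (fst z \<bullet> \<tau>) *\<^sub>R \<tau>" for z :: "R3 \<times> R3"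
  define f2 where "f2 z = inverse (snd z \<bullet> e) *\<^sub>R
      (snd z + (snd z \<bullet> D (fst z \<bullet> \<tau>) - snd z \<bullet> \<tau>) *\<^sub>R \<tau>) + (norm (snd z) - 2) *\<^sub>R e" for z :: "R3 \<times> R3"
  define g1 where "g1 w = fst w + c (fst w \<bullet> \<tau>) - (fst w \<bullet> \<tau>) *\<^sub>R \<tau>" for w :: "R3 \<times> R3"
  define d where "d w = snd w - (snd w \<bullet> e) *\<^sub>R e + e" for w :: "R3 \<times> R3"
  define E where "E w = d w + (d w \<bullet> \<tau> - d w \<bullet> D (fst w \<bullet> \<tau>)) *\<^sub>R \<tau>" for w
  define g2 where "g2 w = ((snd w \<bullet> e + 1) * inverse (norm (E w))) *\<^sub>R E w" for w
  define V0 where "V0 = {w :: R3 \<times> R3. fst w \<bullet> \<tau> \<in> J \<and> snd w \<bullet> e > - 1}"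
  define V where "V = V0 \<inter> g1 -` U"
  have cont: "continuous_on UNIV (\<lambda>z::R3 \<times> R3. fst z \<bullet> \<tau>)" "continuous_on UNIV (\<lambda>z::R3 \<times> R3. snd z \<bullet> e)"
    by (intro continuous_intros)+
  have oO: "open O'"
  proof -
    have "O' = fst -` U \<inter> (\<lambda>z. fst z \<bullet> \<tau>) -` J \<inter> (\<lambda>z. snd z \<bullet> e) -` {0<..}"
      by (auto simp: O'_def)
    moreover have "open (fst -` U :: (R3 \<times> R3) set)"
      by (rule open_vimage_fst[OF U])
    ultimately show ?thesis
      using open_vimage[OF J cont(1)] open_vimage[OF open_greaterThan cont(2)] by (metis open_Int)
  qed
  have oV0: "open V0"
  proof -
    have "V0 = (\<lambda>z. fst z \<bullet> \<tau>) -` J \<inter> (\<lambda>z. snd z \<bullet> e) -` {-1<..}"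
      by (auto simp: V0_def)
    then show ?thesis
      using open_vimage[OF J cont(1)] open_vimage[OF open_greaterThan cont(2)] by (metis open_Int)
  qed
  have base: "C_infinity S fst" "C_infinity S snd" if "open S" for S :: "(R3 \<times> R3) set"
    using that by (auto intro: C_infinity_bounded_linear bounded_linear_fst bounded_linear_snd)
  have lift: "C_infinity S (\<lambda>z. h (fst z \<bullet> \<tau>))"
    if "open S" "\<And>z. z \<in> S \<Longrightarrow> fst z \<bullet> \<tau> \<in> J" "C_infinity J h" for S :: "(R3 \<times> R3) set" and h :: "real \<Rightarrow> R3"
    by (rule C_infinity_compose[OF that(1) J _ C_infinity_inner that(3)])
      (use that base in \<open>auto intro: C_infinity_const\<close>)
  have O'D: "fst z \<in> U" "fst z \<bullet> \<tau> \<in> J" "snd z \<bullet> e > 0" "snd z \<noteq> 0" if "z \<in> O'" for z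
    using that by (auto simp: O'_def)
  have sf: "C_infinity O' (\<lambda>z. (f1 z, f2 z))"
    unfolding f1_def f2_def
    by (intro C_infinity_Pair C_infinity_add C_infinity_diff C_infinity_scaleR C_infinity_inner
        C_infinity_inverse C_infinity_norm C_infinity_const lift base oO D c O'D)
  have Ee: "E w \<bullet> e = 1" for w
    using ee e by (simp add: E_def d_def inner_add_left inner_diff_left)
  then have E0: "E w \<noteq> 0" for w
    by (metis inner_zero_left zero_neq_one)
  have V0D: "fst z \<bullet> \<tau> \<in> J" "snd z \<bullet> e > - 1" if "z \<in> V0" for z
    using that by (auto simp: V0_def)
  have g1: "C_infinity V0 g1"
    unfolding g1_def
    by (intro C_infinity_add C_infinity_diff C_infinity_scaleR C_infinity_inner C_infinity_const
        lift base oV0 c V0D)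
  have d: "C_infinity V0 d"
    unfolding d_def
    by (intro C_infinity_add C_infinity_diff C_infinity_scaleR C_infinity_inner C_infinity_const
        base oV0)
  have E: "C_infinity V0 E"
    unfolding E_def
    by (intro C_infinity_add C_infinity_diff C_infinity_scaleR C_infinity_inner C_infinity_const
        lift base oV0 D d V0D)
  have g2: "C_infinity V0 g2"
    unfolding g2_def
    by (intro C_infinity_add C_infinity_scaleR C_infinity_mult C_infinity_inner C_infinity_const
        C_infinity_inverse C_infinity_norm base oV0 E E0) (simp add: E0)
  have oV: "open V"
    unfolding V_def using C_infinity_continuous_on[OF g1] oV0 U
    by (metis continuous_on_open_vimage inf_commute)
  have sg: "C_infinity V (\<lambda>w. (g1 w, g2 w))"
    by (rule C_infinity_subset[OF C_infinity_Pair[OF oV0 g1 g2]]) (auto simp: V_def)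
  have f1\<tau>: "f1 z \<bullet> \<tau> = fst z \<bullet> \<tau>" if "z \<in> O'" for z
    using cJ O'D(2)[OF that] \<tau> by (simp add: f1_def inner_add_left inner_diff_left)
  have f2e: "f2 z \<bullet> e = norm (snd z) - 1" if "z \<in> O'" for z
    using O'D(3)[OF that] e ee by (simp add: f2_def inner_add_left)
  have f2\<tau>: "f2 z \<bullet> \<tau> = (snd z \<bullet> D (fst z \<bullet> \<tau>)) * inverse (snd z \<bullet> e)" for z
    using \<tau> ee by (simp add: f2_def inner_add_left)
  have fV: "(f1 z, f2 z) \<in> V \<and> (g1 (f1 z, f2 z), g2 (f1 z, f2 z)) = z" if z: "z \<in> O'" for z
  proof -
    have 1: "g1 (f1 z, f2 z) = fst z"
      by (simp add: g1_def f1\<tau>[OF z]) (simp add: f1_def)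
    have "norm (snd z) > 0" using O'D(4)[OF z] by simp
    then have "(f1 z, f2 z) \<in> V"
      using O'D[OF z] 1 f1\<tau>[OF z] f2e[OF z] by (simp add: V_def V0_def)
    moreover have dz: "d (f1 z, f2 z) = inverse (snd z \<bullet> e) *\<^sub>R
        (snd z + (snd z \<bullet> D (fst z \<bullet> \<tau>) - snd z \<bullet> \<tau>) *\<^sub>R \<tau>)"
      by (simp add: d_def f2e[OF z]) (simp add: f2_def algebra_simps scaleR_2)
    have "E (f1 z, f2 z) = inverse (snd z \<bullet> e) *\<^sub>R snd z"
      unfolding E_def dz using \<tau> D\<tau>[OF O'D(2)[OF z]]
      by (simp add: f1\<tau>[OF z] inner_add_left algebra_simps)
    then have "g2 (f1 z, f2 z) = snd z"
      using O'D(3,4)[OF z] less_imp_neq[OF O'D(3)[OF z]]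
      by (simp add: g2_def f2e[OF z] inverse_eq_divide)
    ultimately show ?thesis using 1 by simp
  qed
  have gO: "(g1 w, g2 w) \<in> O' \<and> (f1 (g1 w, g2 w), f2 (g1 w, g2 w)) = w" if w: "w \<in> V" for w
  proof -
    have w': "fst w \<bullet> \<tau> \<in> J" "snd w \<bullet> e > -1" "g1 w \<in> U"
      using w by (auto simp: V_def V0_def)
    have g1\<tau>: "g1 w \<bullet> \<tau> = fst w \<bullet> \<tau>"
      using cJ w'(1) \<tau> by (simp add: g1_def inner_add_left inner_diff_left)
    have nE: "norm (E w) > 0" using E0 by simp
    have k: "(snd w \<bullet> e + 1) * inverse (norm (E w)) > 0"
      using w'(2) nE by (intro mult_pos_pos) auto
    have g2e: "g2 w \<bullet> e = (snd w \<bullet> e + 1) * inverse (norm (E w))"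
      by (simp add: g2_def Ee)
    have O: "(g1 w, g2 w) \<in> O'"
      using w' g1\<tau> g2e k by (simp add: O'_def)
    have "norm (g2 w) = snd w \<bullet> e + 1"
      using k nE w'(2) by (simp add: g2_def abs_mult)
    moreover have "inverse (g2 w \<bullet> e) *\<^sub>R g2 w = E w"
      unfolding g2e unfolding g2_def scaleR_scaleR left_inverse[OF less_imp_neq[OF k, symmetric]]
      by (rule scaleR_one)
    moreover have "inverse (g2 w \<bullet> e) *\<^sub>R (g2 w + (g2 w \<bullet> D (fst w \<bullet> \<tau>) - g2 w \<bullet> \<tau>) *\<^sub>R \<tau>)
        = inverse (g2 w \<bullet> e) *\<^sub>R g2 w + ((inverse (g2 w \<bullet> e) *\<^sub>R g2 w) \<bullet> D (fst w \<bullet> \<tau>)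
            - (inverse (g2 w \<bullet> e) *\<^sub>R g2 w) \<bullet> \<tau>) *\<^sub>R \<tau>"
      by (simp add: algebra_simps)
    moreover have "E w + (E w \<bullet> D (fst w \<bullet> \<tau>) - E w \<bullet> \<tau>) *\<^sub>R \<tau> = d w"
      using \<tau> D\<tau>[OF w'(1)] by (simp add: E_def inner_add_left algebra_simps)
    ultimately have "f2 (g1 w, g2 w) = d w + (snd w \<bullet> e + 1 - 2) *\<^sub>R e"
      unfolding f2_def fst_conv snd_conv g1\<tau> by metis
    then have "f2 (g1 w, g2 w) = snd w"
      by (simp add: d_def algebra_simps)
    moreover have "f1 (g1 w, g2 w) = fst w"
      by (simp add: f1_def g1\<tau>) (simp add: g1_def)
    ultimately show ?thesis using O by simp
  qed
  have diff: "diffeomorphism O' V (\<lambda>z. (f1 z, f2 z))"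
    by (rule diffeomorphism_openI[OF oO oV sf sg fV gO])
  have iff: "z \<in> unit_conormal K \<longleftrightarrow> (f1 z, f2 z) \<in> span {\<tau>} \<times> {z. z \<bullet> \<tau> = 0 \<and> z \<bullet> e = 0}"
    if z: "z \<in> O'" for z
  proof -
    have "fst z \<in> K \<longleftrightarrow> f1 z \<in> span {\<tau>}"
    proof
      assume "fst z \<in> K"
      then show "f1 z \<in> span {\<tau>}"
        using cU[of "fst z"] O'D(1)[OF z] by (simp add: f1_def span_base span_mul)
    next
      assume "f1 z \<in> span {\<tau>}"
      then obtain k where k: "f1 z = k *\<^sub>R \<tau>"
        by (auto simp: span_singleton)
      then have "k = fst z \<bullet> \<tau>"
        using f1\<tau>[OF z] \<tau> by simp
      then have "fst z = c (fst z \<bullet> \<tau>)"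
        using k by (simp add: f1_def)
      then show "fst z \<in> K"
        using cJ O'D(2)[OF z] by metis
    qed
    moreover have "normal_to K (fst z) (snd z) \<longleftrightarrow> f2 z \<bullet> \<tau> = 0" if "fst z \<in> K"
      using normal_to_graph_iff[OF G, of "fst z" "snd z"] that O'D[OF z] by (simp add: f2\<tau> D_def)
    moreover have "norm (snd z) = 1 \<longleftrightarrow> f2 z \<bullet> e = 0"
      by (simp add: f2e[OF z])
    ultimately show ?thesis
      by (auto simp: unit_conormal_def unit_cotangent_def normal_to_def case_prod_beta)
  qed
  have "(\<lambda>z. (f1 z, f2 z)) ` (O' \<inter> unit_conormal K)
      = V \<inter> (span {\<tau>} \<times> {z. z \<bullet> \<tau> = 0 \<and> z \<bullet> e = 0})"
  proof (intro equalityI subsetI)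
    fix w assume "w \<in> (\<lambda>z. (f1 z, f2 z)) ` (O' \<inter> unit_conormal K)"
    then show "w \<in> V \<inter> (span {\<tau>} \<times> {z. z \<bullet> \<tau> = 0 \<and> z \<bullet> e = 0})"
      using fV iff by blast
  next
    fix w assume w: "w \<in> V \<inter> (span {\<tau>} \<times> {z. z \<bullet> \<tau> = 0 \<and> z \<bullet> e = 0})"
    then have "(g1 w, g2 w) \<in> O' \<inter> unit_conormal K" "w = (\<lambda>z. (f1 z, f2 z)) (g1 w, g2 w)"
      using gO[of w] iff[of "(g1 w, g2 w)"] by auto
    then show "w \<in> (\<lambda>z. (f1 z, f2 z)) ` (O' \<inter> unit_conormal K)"
      by (rule rev_image_eqI)
  qed
  with oO oV diff show thesis by (rule that)
qed

lemma unit_conormal_submanifold: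
  assumes "embedded_curve K"
  shows "submanifold 2 (unit_conormal K)"
  unfolding submanifold_def
proof
  fix z assume z: "z \<in> unit_conormal K"
  then have q: "fst z \<in> K" and p: "norm (snd z) = 1" "normal_to K (fst z) (snd z)"
    by (auto simp: unit_conormal_def unit_cotangent_def normal_to_def)
  obtain \<tau> J c U where "fst z \<in> U" and G: "local_graph K \<tau> J c U"
    using assms q unfolding embedded_curve_def by blast
  then have qU: "fst z \<in> U \<inter> K" using q by blast
  define D where "D = vector_derivative c (at (fst z \<bullet> \<tau>))"
  have a: "fst z \<bullet> \<tau> \<in> J" and \<tau>: "\<tau> \<bullet> \<tau> = 1" "norm \<tau> = 1"
    using G qU by (auto simp: local_graph_def norm_eq_1)
  have pD: "snd z \<bullet> D = 0" using p(2) normal_to_graph_iff[OF G qU] by (simp add: D_def)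
  have \<tau>D: "\<tau> \<bullet> D = 1" using graph_derivative_inner[OF G a] by (simp add: D_def inner_commute)
  \<comment> \<open>The line along \<open>\<tau>\<close> need not be tangent at \<open>z\<close>, so the fibre coordinate \<open>e\<close> is the part of the
    covector orthogonal to \<open>\<tau>\<close>. It is not zero: \<open>\<tau>\<close> pairs to 1 with the curve's velocity \<open>D\<close>
    and the covector to 0.\<close>
  define e0 where "e0 = snd z - (snd z \<bullet> \<tau>) *\<^sub>R \<tau>"
  have "e0 \<noteq> 0"
  proof
    assume "e0 = 0"
    then have "snd z = (snd z \<bullet> \<tau>) *\<^sub>R \<tau>" by (simp add: e0_def)
    then have "snd z \<bullet> D = snd z \<bullet> \<tau>" using \<tau>D by (metis inner_scaleR_left mult.right_neutral)
    then have "snd z = 0" using pD \<open>snd z = (snd z \<bullet> \<tau>) *\<^sub>R \<tau>\<close> by simp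
    then show False using p(1) by simp
  qed
  define e where "e = e0 /\<^sub>R norm e0"
  have e: "norm e = 1" "\<tau> \<bullet> e = 0"
    using \<open>e0 \<noteq> 0\<close> \<tau>(1) by (simp_all add: e_def e0_def inner_diff_right inner_commute)
  have "snd z \<bullet> e0 = e0 \<bullet> e0"
    using \<tau>(1) by (simp add: e0_def inner_diff_left inner_diff_right inner_commute algebra_simps)
  then have ze: "snd z \<bullet> e > 0"
    using \<open>e0 \<noteq> 0\<close> by (simp add: e_def)
  have ne: "\<tau> \<noteq> 0" "e \<noteq> 0" using \<tau>(2) e(1) by auto
  obtain V \<phi> where "open {z. fst z \<in> U \<and> fst z \<bullet> \<tau> \<in> J \<and> snd z \<bullet> e > 0}" "open V"
    "diffeomorphism {z. fst z \<in> U \<and> fst z \<bullet> \<tau> \<in> J \<and> snd z \<bullet> e > 0} V \<phi>"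
    "\<phi> ` ({z. fst z \<in> U \<and> fst z \<bullet> \<tau> \<in> J \<and> snd z \<bullet> e > 0} \<inter> unit_conormal K)
      = V \<inter> (span {\<tau>} \<times> {z. z \<bullet> \<tau> = 0 \<and> z \<bullet> e = 0})"
    by (rule unit_conormal_chart[OF G e])
  moreover have "z \<in> {z. fst z \<in> U \<and> fst z \<bullet> \<tau> \<in> J \<and> snd z \<bullet> e > 0}"
    using qU a ze by simp
  ultimately show "\<exists>U V W \<phi>. open U \<and> z \<in> U \<and> open V \<and> subspace W \<and> dim W = 2 \<and>
      diffeomorphism U V \<phi> \<and> \<phi> ` (U \<inter> unit_conormal K) = V \<inter> (W :: (R3 \<times> R3) set)"
    using dim_line_times_orthogonal[OF ne e(2)] by (intro exI conjI)
qed

lemma tangent_space_linear_image: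
  assumes L: "bounded_linear L" and sub: "L ` M \<subseteq> N" and u: "u \<in> tangent_space M z"
  shows "L u \<in> tangent_space N (L z)"
proof -
  obtain \<delta> b where b: "\<delta> > 0" "smooth_on {-\<delta><..<\<delta>} b" "b ` {-\<delta><..<\<delta>} \<subseteq> M" "b 0 = z"
      "(b has_vector_derivative u) (at 0)"
    using u unfolding tangent_space_def by blast
  have "smooth_on {-\<delta><..<\<delta>} (\<lambda>s. L (b s))"
    using b(2) C_infinity_linear_compose[OF L open_greaterThanLessThan] by (simp add: smooth_on_open_iff)
  moreover have "(\<lambda>s. L (b s)) ` {-\<delta><..<\<delta>} \<subseteq> N"
    using b(3) sub by blast
  moreover have "((\<lambda>s. L (b s)) has_vector_derivative L u) (at 0)"
    by (rule bounded_linear.has_vector_derivative[OF L b(5)])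
  ultimately show ?thesis
    unfolding tangent_space_def using b(1,4)
    by (auto intro!: exI[of _ \<delta>] exI[of _ "\<lambda>s. L (b s)"])
qed

text \<open>Along a curve \<open>(q - r p, p)\<close> with \<open>(q, p)\<close> conormal to \<open>K\<close>, the form \<open>p dq\<close> picks up only
  \<open>- r p \<bullet> p'\<close>, which vanishes because \<open>p\<close> has norm 1.\<close>

lemma legendrian_shifted_conormal:
  assumes "embedded_curve K"
  shows "legendrian ((\<lambda>(q, p). (q - r *\<^sub>R p, p)) ` unit_conormal K)"
proof -
  define m where "m z = (fst z - r *\<^sub>R snd z, snd z)" for z :: "R3 \<times> R3"
  define l where "l z = (fst z + r *\<^sub>R snd z, snd z)" for z :: "R3 \<times> R3"
  have m: "(\<lambda>(q, p). (q - r *\<^sub>R p, p)) = m" by (auto simp: m_def)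
  have lin: "bounded_linear m" "bounded_linear l"
    unfolding m_def l_def by (intro bounded_linear_intros)+
  have "submanifold 2 (m ` unit_conormal K)"
    by (rule submanifold_image[OF unit_conormal_submanifold[OF assms]
          C_infinity_bounded_linear[OF open_UNIV lin(1)] C_infinity_bounded_linear[OF open_UNIV lin(2)]])
      (auto simp: m_def l_def)
  moreover have "m ` unit_conormal K \<subseteq> unit_cotangent"
    by (auto simp: m_def unit_conormal_def unit_cotangent_def)
  moreover have "contact_form z u = 0"
    if z: "z \<in> m ` unit_conormal K" and u: "u \<in> tangent_space (m ` unit_conormal K) z" for z u
  proof -
    have n: "normal_to K (fst z + r *\<^sub>R snd z) (snd z)"
      using z by (auto simp: m_def unit_conormal_def normal_to_def)
    have "bounded_linear (\<lambda>z::R3 \<times> R3. fst z + r *\<^sub>R snd z)"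
      by (intro bounded_linear_intros)
    then have "fst u + r *\<^sub>R snd u \<in> tangent_space K (fst z + r *\<^sub>R snd z)"
      by (rule tangent_space_linear_image[OF _ _ u]) (auto simp: m_def unit_conormal_def)
    with n have 1: "snd z \<bullet> (fst u + r *\<^sub>R snd u) = 0"
      by (simp add: normal_to_def)
    have "snd u \<in> tangent_space (sphere 0 1) (snd z)"
      by (rule tangent_space_linear_image[OF bounded_linear_snd _ u])
        (auto simp: m_def unit_conormal_def unit_cotangent_def)
    moreover have "norm (snd z) = 1"
      using z by (auto simp: m_def unit_conormal_def unit_cotangent_def)
    ultimately have "(0 - snd z) \<bullet> snd u = 0"
      by (intro tangent_orthogonal_at_nearest[of "sphere 0 1"]) auto
    with 1 show ?thesis by (simp add: contact_form_def inner_add_right)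
  qed
  ultimately show ?thesis by (simp add: legendrian_def m)
qed

section \<open>The isotopy\<close>

lemma diffeomorphism_restrict:
  assumes "C_infinity UNIV f" "C_infinity UNIV g"
    and f: "\<And>x. x \<in> S \<Longrightarrow> f x \<in> T \<and> g (f x) = x" and g: "\<And>y. y \<in> T \<Longrightarrow> g y \<in> S \<and> f (g y) = y"
  shows "diffeomorphism S T f"
proof -
  have b: "bij_betw f S T"
    by (rule bij_betw_byWitness[where f' = g]) (use f g in auto)
  have "g y = inv_into S f y" if "y \<in> T" for y
    by (metis g that b bij_betw_def inv_into_f_f)
  then have "smooth_on T (inv_into S f)"
    unfolding smooth_on_def using assms(2) by (metis Int_iff UNIV_I open_UNIV)
  moreover have "smooth_on S f"
    by (rule smooth_on_if_C_infinity[OF open_UNIV subset_UNIV assms(1)])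
  ultimately show ?thesis
    unfolding diffeomorphism_def using b by blast
qed

text \<open>Time is scaled so that the unit interval ends at the torus of radius \<open>\<epsilon>\<close>.\<close>

definition backward_geodesic_flow :: "real \<Rightarrow> real \<Rightarrow> R3 \<times> R3 \<Rightarrow> R3 \<times> R3" where
  "backward_geodesic_flow \<epsilon> t = (\<lambda>(q, p). (q - (t * \<epsilon>) *\<^sub>R p, p))"

lemma smooth_backward_geodesic_flow:
  "smooth_on S (\<lambda>(t, z). backward_geodesic_flow \<epsilon> t z)"
proof (rule smooth_on_if_C_infinity[OF open_UNIV subset_UNIV])
  have "C_infinity UNIV (\<lambda>w::real \<times> R3 \<times> R3.
      (fst (snd w) - (fst w * \<epsilon>) *\<^sub>R snd (snd w), snd (snd w)))"
    by (intro C_infinity_Pair C_infinity_diff C_infinity_scaleR C_infinity_mult C_infinity_const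
        C_infinity_fst C_infinity_snd C_infinity_id open_UNIV)
  then show "C_infinity UNIV (\<lambda>(t, z). backward_geodesic_flow \<epsilon> t z)"
    by (simp add: backward_geodesic_flow_def case_prod_beta')
qed

lemma diffeomorphism_backward_geodesic_flow:
  "diffeomorphism unit_cotangent unit_cotangent (backward_geodesic_flow \<epsilon> t)"
proof -
  have smooth: "C_infinity UNIV (backward_geodesic_flow \<epsilon> s)" for s
  proof -
    have "C_infinity UNIV (\<lambda>z::R3 \<times> R3. (fst z - (s * \<epsilon>) *\<^sub>R snd z, snd z))"
      by (intro C_infinity_Pair C_infinity_diff C_infinity_scaleR C_infinity_const
          C_infinity_fst C_infinity_snd C_infinity_id open_UNIV)
    then show ?thesis
      by (simp add: backward_geodesic_flow_def case_prod_beta')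
  qed
  show ?thesis
    by (rule diffeomorphism_restrict[OF smooth smooth[of "- t"]])
      (auto simp: backward_geodesic_flow_def unit_cotangent_def)
qed

lemma knot_flow_image:
  assumes "knot K"
  obtains \<epsilon>\<^sub>0 where "\<epsilon>\<^sub>0 > 0"
    "\<And>\<epsilon> t. 0 < \<epsilon> \<Longrightarrow> \<epsilon> < \<epsilon>\<^sub>0 \<Longrightarrow> 0 < t \<Longrightarrow> t \<le> 1 \<Longrightarrow>
      backward_geodesic_flow \<epsilon> t ` unit_conormal K = inward_conormal K (t * \<epsilon>)"
proof -
  note K = knot_compact[OF assms] knot_nonempty[OF assms] knot_embedded_curve[OF assms]
  obtain C where C: "C > 0" "reach_bound K C"
    using reach_bound_exists[OF K(1,3)] by blast
  have "backward_geodesic_flow \<epsilon> t ` unit_conormal K = inward_conormal K (t * \<epsilon>)"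
    if "0 < \<epsilon>" "\<epsilon> < 1 / (2 * C)" "0 < t" "t \<le> 1" for \<epsilon> t
  proof -
    have "2 * C * (t * \<epsilon>) \<le> 2 * C * \<epsilon>"
      using that C(1) by (intro mult_left_mono mult_left_le_one_le) auto
    also have "\<dots> < 1"
      using that(2) C(1) by (simp add: pos_less_divide_eq mult.commute)
    finally show ?thesis
      using inward_conormal_eq[OF K C(2), of "t * \<epsilon>"] C(1) that
      by (simp add: backward_geodesic_flow_def)
  qed
  with C(1) show thesis
    by (intro that[of "1 / (2 * C)"]) auto
qed

theorem lemma296:
  shows "\<exists>\<Phi>. canonical_isotopies \<Phi> \<and>
    (\<forall>K. knot K \<longrightarrow>
      (\<exists>\<epsilon>\<^sub>0>0. \<forall>\<epsilon>. 0 < \<epsilon> \<and> \<epsilon> < \<epsilon>\<^sub>0 \<longrightarrow>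
        legendrian_isotopy (\<Phi> K \<epsilon>) (unit_conormal K) (inward_conormal K \<epsilon>)))"
proof -
  define \<Phi> where "\<Phi> = (\<lambda>(K :: R3 set). backward_geodesic_flow)"
  have "\<Phi> ((\<lambda>x. R x + b) ` K) \<epsilon> t (isometry_lift R b z) = isometry_lift R b (\<Phi> K \<epsilon> t z)"
    if "orthogonal_transformation R" for K R b \<epsilon> t z
    using orthogonal_transformation_linear[OF that]
    by (cases z) (simp add: \<Phi>_def backward_geodesic_flow_def isometry_lift_def linear_diff linear_cmul)
  moreover have "\<exists>\<epsilon>\<^sub>0>0. \<forall>\<epsilon>. 0 < \<epsilon> \<and> \<epsilon> < \<epsilon>\<^sub>0 \<longrightarrow> (\<forall>t. 0 < t \<and> t \<le> 1 \<longrightarrow>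
      \<Phi> K \<epsilon> t ` unit_conormal K = inward_conormal K (t * \<epsilon>))" if "knot K" for K
    using knot_flow_image[OF that] by (metis \<Phi>_def)
  ultimately have "canonical_isotopies \<Phi>"
    unfolding canonical_isotopies_def by blast
  moreover have "\<exists>\<epsilon>\<^sub>0>0. \<forall>\<epsilon>. 0 < \<epsilon> \<and> \<epsilon> < \<epsilon>\<^sub>0 \<longrightarrow>
      legendrian_isotopy (\<Phi> K \<epsilon>) (unit_conormal K) (inward_conormal K \<epsilon>)" if K: "knot K" for K
  proof -
    obtain \<epsilon>\<^sub>0 where \<epsilon>\<^sub>0: "\<epsilon>\<^sub>0 > 0" "\<And>\<epsilon> t. 0 < \<epsilon> \<Longrightarrow> \<epsilon> < \<epsilon>\<^sub>0 \<Longrightarrow> 0 < t \<Longrightarrow> t \<le> 1 \<Longrightarrow>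
        backward_geodesic_flow \<epsilon> t ` unit_conormal K = inward_conormal K (t * \<epsilon>)"
      using knot_flow_image[OF K] by blast
    have "legendrian_isotopy (\<Phi> K \<epsilon>) (unit_conormal K) (inward_conormal K \<epsilon>)"
      if \<epsilon>: "0 < \<epsilon>" "\<epsilon> < \<epsilon>\<^sub>0" for \<epsilon>
      unfolding legendrian_isotopy_def
    proof (intro conjI ballI)
      show "smooth_on ({0..1} \<times> unit_cotangent) (\<lambda>(t, z). \<Phi> K \<epsilon> t z)"
        unfolding \<Phi>_def by (rule smooth_backward_geodesic_flow)
      show "diffeomorphism unit_cotangent unit_cotangent (\<Phi> K \<epsilon> t)" for t
        unfolding \<Phi>_def by (rule diffeomorphism_backward_geodesic_flow)
      show "\<Phi> K \<epsilon> 0 z = z" for z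
        by (simp add: \<Phi>_def backward_geodesic_flow_def case_prod_beta)
      show "legendrian (\<Phi> K \<epsilon> t ` unit_conormal K)" for t
        unfolding \<Phi>_def backward_geodesic_flow_def
        by (rule legendrian_shifted_conormal[OF knot_embedded_curve[OF K]])
      show "\<Phi> K \<epsilon> 1 ` unit_conormal K = inward_conormal K \<epsilon>"
        using \<epsilon>\<^sub>0(2)[OF \<epsilon>, of 1] by (simp add: \<Phi>_def)
    qed
    with \<epsilon>\<^sub>0(1) show ?thesis
      by blast
  qed
  ultimately show ?thesis by blast
qed

end
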